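(* Let $\mathcal{H}$ be a Hilbert space, $(X,\mathcal{B},\mu)$ a measure space, and $|\cdot|\colon\mathcal{H}\to L^2_+(X,\mu)$ an absolute pairing. Let $\mathfrak{a}$ be a closed form in $\mathcal{H}$, let $\mathfrak{b}$ be a closed form in $L^2(X,\mu)$ satisfying the first Beurling-Deny criterion, and let $D_{\mathfrak{a}}\subset D(\mathfrak{a})$ and $D_{\mathfrak{b}}\subset D(\mathfrak{b})$ be ideals (of $D(\mathfrak{a})$ and of $D(\mathfrak{b})$, respectively) such that the following conditions hold: (1) $\mathfrak{a}$ is dominated by $\mathfrak{b}$; (2) $D_{\mathfrak{b}}^+\cap |D(\mathfrak{a})|\subset |D_{\mathfrak{a}}|$. If $D_{\mathfrak{b}}$ is a core for $\mathfrak{b}$, then $D_{\mathfrak{a}}$ is a core for $\mathfrak{a}$.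
   Context: All Hilbert spaces are complex. A quadratic form $q$ on a Hilbert space $H$ is given on a dense subspace $D(q)\subset H$, takes real values, and is identified with the sesquilinear form on $D(q)\times D(q)$ it induces by polarization, $q(f,g)=\frac14\sum_{k=1}^4 i^k q(f+i^kg)$. It is lower bounded if there is $\lambda\in\mathbb{R}$ with $q(f)\ge -\lambda\|f\|^2$ for all $f\in D(q)$. The form norm is $\|f\|_q=(q(f)+\mu_0\|f\|^2)^{1/2}$ for a fixed real $\mu_0>\lambda$ (different choices give equivalent norms). A closed form is a lower bounded form for which $(D(q),\|\cdot\|_q)$ is complete. A core for $q$ is a subspace of $D(q)$ that is dense with respect to $\|\cdot\|_q$. A form $q$ on $L^2(X,\mu)$ is real if $f\in D(q)$ implies $\bar f\in D(q)$ and $q(\bar f)=q(f)$. A real form satisfies the first Beurling-Deny criterion if $f\in D(q)$ implies $|f|\in D(q)$ and $q(|f|)\le q(f)$. $L^2_+(X,\mu)$ is the set of nonnegative functions in $L^2(X,\mu)$; for a subspace $V\subset L^2(X,\mu)$, $V_+$ or $V^+$ denotes $V\cap L^2_+(X,\mu)$. A map $|\cdot|\colon\mathcal{H}\to L^2_+(X,\mu)$ is an absolute map if $|\langle\xi,\eta\rangle|\le\langle|\xi|,|\eta|\rangle$ for all $\xi,\eta\in\mathcal{H}$, with equality if $\xi=\eta$. Elements $\xi,\eta\in\mathcal{H}$ are paired if $\langle\xi,\eta\rangle=\langle|\xi|,|\eta|\rangle$. An absolute map is an absolute pairing if for all $\xi\in\mathcal{H}$ and $f\in L^2_+(X,\mu)$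 there is $\eta\in\mathcal{H}$ such that $|\eta|=f$ and $\xi,\eta$ are paired. For a subspace $V\subset\mathcal{H}$ put $|V|=\{|v|: v\in V\}$. A subspace $U\subset\mathcal{H}$ is a generalized ideal of a subspace $V\subset L^2(X,\mu)$ if for all $\xi\in U$ one has $|\xi|\in V$, and for every $f\in V$ with $0\le f\le|\xi|$ there is $\eta\in U$ such that $|\eta|=f$ and $\xi,\eta$ are paired. The closed form $\mathfrak{a}$ on $\mathcal{H}$ is dominated by the closed form $\mathfrak{b}$ on $L^2(X,\mu)$ if $D(\mathfrak{a})$ is a generalized ideal of $D(\mathfrak{b})$ and $\operatorname{Re}\mathfrak{a}(\xi,\eta)\ge\mathfrak{b}(|\xi|,|\eta|)$ whenever $\xi,\eta\in D(\mathfrak{a})$ are paired. For subspaces $U\subset V$ of $\mathcal{H}$, $U$ is an ideal of $V$ if $f\in U$, $g\in V$ and $|g|\le|f|$ imply $g\in U$. For subspaces of $L^2(X,\mu)$ this is meant with respect to the pointwise modulus. *)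

theory Defs
  imports
    "HOL-Analysis.Analysis"
    "HOL-Algebra.Algebraic_Closure_Type"
    "HOL-Library.Complex_Order"
begin

section \<open>Complex Hilbert spaces\<close>

text \<open>
  The space \<open>L2 M\<close> below depends on the measure \<open>M\<close>, so Hilbert spaces are
  records with an explicit carrier, extending the modules of HOL-Algebra over the ring of complex
  numbers.  The ring multiplication and ring unit that such a record inherits play no role.
  Inner products are linear in the first argument; this is the convention under which the
  polarization formula below recovers a sesquilinear form from its diagonal.
\<close>

abbreviation complex_ring :: "complex ring" where
  "complex_ring \<equiv> ring_of_type_algebra"

record 'a hilbert = "(complex, 'a) module" +
  cinner :: "'a \<Rightarrow> 'a \<Rightarrow> complex"

definition hnorm :: "('a, 'c) hilbert_scheme \<Rightarrow> 'a \<Rightarrow> real" where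
  "hnorm H f = sqrt (Re (cinner H f f))"

abbreviation subspace_of :: "('a, 'c) hilbert_scheme \<Rightarrow> 'a set \<Rightarrow> bool" where
  "subspace_of H U \<equiv> submodule U complex_ring H"

text \<open>
  Completeness of, and density in, a subspace \<open>D\<close> with respect to a norm \<open>N\<close> on \<open>D\<close>.
\<close>

definition complete_wrt :: "('a, 'c) hilbert_scheme \<Rightarrow> ('a \<Rightarrow> real) \<Rightarrow> 'a set \<Rightarrow> bool" where
  "complete_wrt H N D \<longleftrightarrow>
     (\<forall>s :: nat \<Rightarrow> 'a.
        (\<forall>n. s n \<in> D) \<and>
        (\<forall>e>0. \<exists>n0. \<forall>m\<ge>n0. \<forall>n\<ge>n0. N (s m \<ominus>\<^bsub>H\<^esub> s n) < e) \<longrightarrow>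
        (\<exists>l\<in>D. (\<lambda>n. N (s n \<ominus>\<^bsub>H\<^esub> l)) \<longlonglongrightarrow> 0))"

definition dense_wrt :: "('a, 'c) hilbert_scheme \<Rightarrow> ('a \<Rightarrow> real) \<Rightarrow> 'a set \<Rightarrow> 'a set \<Rightarrow> bool" where
  "dense_wrt H N U D \<longleftrightarrow> U \<subseteq> D \<and> (\<forall>f\<in>D. \<forall>e>0. \<exists>g\<in>U. N (f \<ominus>\<^bsub>H\<^esub> g) < e)"

locale complex_hilbert_space = module complex_ring H
  for H :: "('a, 'c) hilbert_scheme" (structure) +
  assumes cinner_add: "\<lbrakk>f \<in> carrier H; g \<in> carrier H; h \<in> carrier H\<rbrakk> \<Longrightarrow>
      cinner H (f \<oplus> g) h = cinner H f h + cinner H g h"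
    and cinner_smult: "\<lbrakk>f \<in> carrier H; g \<in> carrier H\<rbrakk> \<Longrightarrow>
      cinner H (c \<odot> f) g = c * cinner H f g"
    and cinner_commute: "\<lbrakk>f \<in> carrier H; g \<in> carrier H\<rbrakk> \<Longrightarrow>
      cinner H g f = cnj (cinner H f g)"
    and cinner_nonneg: "f \<in> carrier H \<Longrightarrow> 0 \<le> cinner H f f"
    and cinner_definite: "\<lbrakk>f \<in> carrier H; cinner H f f = 0\<rbrakk> \<Longrightarrow> f = \<zero>"
    and complete: "complete_wrt H (hnorm H) (carrier H)"


section \<open>Quadratic forms\<close>

record 'a qform =
  qdom :: "'a set"
  qval :: "'a \<Rightarrow> real"

definition polar :: "('a, 'c) hilbert_scheme \<Rightarrow> 'a qform \<Rightarrow> 'a \<Rightarrow> 'a \<Rightarrow> complex" where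
  "polar H q f g =
     (\<Sum>k = 1..4::nat. \<i> ^ k * complex_of_real (qval q (f \<oplus>\<^bsub>H\<^esub> (\<i> ^ k) \<odot>\<^bsub>H\<^esub> g))) / 4"

definition sesquilinear_on ::
    "('a, 'c) hilbert_scheme \<Rightarrow> 'a set \<Rightarrow> ('a \<Rightarrow> 'a \<Rightarrow> complex) \<Rightarrow> bool" where
  "sesquilinear_on H D B \<longleftrightarrow>
     (\<forall>f\<in>D. \<forall>g\<in>D. \<forall>h\<in>D. \<forall>c.
        B (f \<oplus>\<^bsub>H\<^esub> g) h = B f h + B g h \<and> B (c \<odot>\<^bsub>H\<^esub> f) h = c * B f h \<and>
        B h (f \<oplus>\<^bsub>H\<^esub> g) = B h f + B h g \<and> B h (c \<odot>\<^bsub>H\<^esub> f) = cnj c * B h f)"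

text \<open>
  A real-valued function on a dense subspace which is the diagonal of the sesquilinear form that
  it induces by polarization.
\<close>

definition quadratic_form :: "('a, 'c) hilbert_scheme \<Rightarrow> 'a qform \<Rightarrow> bool" where
  "quadratic_form H q \<longleftrightarrow>
     subspace_of H (qdom q) \<and>
     dense_wrt H (hnorm H) (qdom q) (carrier H) \<and>
     sesquilinear_on H (qdom q) (polar H q) \<and>
     (\<forall>f\<in>qdom q. polar H q f f = complex_of_real (qval q f))"

definition form_norm :: "('a, 'c) hilbert_scheme \<Rightarrow> 'a qform \<Rightarrow> real \<Rightarrow> 'a \<Rightarrow> real" where
  "form_norm H q \<mu>\<^sub>0 f = sqrt (qval q f + \<mu>\<^sub>0 * (hnorm H f)\<^sup>2)"

text \<open>
  The number \<open>\<mu>\<^sub>0\<close> that enters the form norm is kept as a parameter.  Being closed and being a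
  core do not depend on it as long as it exceeds some \<open>l\<close> for which \<open>-l\<close> is a lower bound of the
  form, because all these form norms are equivalent.
\<close>

definition form_shift :: "('a, 'c) hilbert_scheme \<Rightarrow> 'a qform \<Rightarrow> real \<Rightarrow> bool" where
  "form_shift H q \<mu>\<^sub>0 \<longleftrightarrow> (\<exists>l. \<mu>\<^sub>0 > l \<and> (\<forall>f\<in>qdom q. qval q f \<ge> - l * (hnorm H f)\<^sup>2))"

definition closed_form :: "('a, 'c) hilbert_scheme \<Rightarrow> 'a qform \<Rightarrow> real \<Rightarrow> bool" where
  "closed_form H q \<mu>\<^sub>0 \<longleftrightarrow>
     quadratic_form H q \<and> form_shift H q \<mu>\<^sub>0 \<and> complete_wrt H (form_norm H q \<mu>\<^sub>0) (qdom q)"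

definition is_core :: "('a, 'c) hilbert_scheme \<Rightarrow> 'a qform \<Rightarrow> real \<Rightarrow> 'a set \<Rightarrow> bool" where
  "is_core H q \<mu>\<^sub>0 U \<longleftrightarrow> subspace_of H U \<and> dense_wrt H (form_norm H q \<mu>\<^sub>0) U (qdom q)"


section \<open>The complex Hilbert space of square integrable functions\<close>

definition L2_fun :: "'x measure \<Rightarrow> ('x \<Rightarrow> complex) set" where
  "L2_fun M = {f \<in> borel_measurable M. integrable M (\<lambda>x. (cmod (f x))\<^sup>2)}"

definition L2_rel :: "'x measure \<Rightarrow> (('x \<Rightarrow> complex) \<times> ('x \<Rightarrow> complex)) set" where
  "L2_rel M = {(f, g). f \<in> L2_fun M \<and> g \<in> L2_fun M \<and> (AE x in M. f x = g x)}"

definition L2_class :: "'x measure \<Rightarrow> ('x \<Rightarrow> complex) \<Rightarrow> ('x \<Rightarrow> complex) set" where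
  "L2_class M f = L2_rel M `` {f}"

text \<open>
  An arbitrary representative of a class.  It is only used in ways that do not depend on the
  choice: under integrals, in almost everywhere statements and inside \<^term>\<open>L2_class\<close>.
\<close>

definition L2_rep :: "('x \<Rightarrow> complex) set \<Rightarrow> 'x \<Rightarrow> complex" where
  "L2_rep F = (SOME f. f \<in> F)"

definition L2 :: "'x measure \<Rightarrow> ('x \<Rightarrow> complex) set hilbert" where
  "L2 M = \<lparr>
     carrier = L2_fun M // L2_rel M,
     mult = undefined,
     one = undefined,
     zero = L2_class M (\<lambda>x. 0),
     add = (\<lambda>F G. L2_class M (\<lambda>x. L2_rep F x + L2_rep G x)),
     smult = (\<lambda>c F. L2_class M (\<lambda>x. c * L2_rep F x)),
     cinner = (\<lambda>F G. \<integral>x. L2_rep F x * cnj (L2_rep G x) \<partial>M)\<rparr>"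

definition L2_cnj :: "'x measure \<Rightarrow> ('x \<Rightarrow> complex) set \<Rightarrow> ('x \<Rightarrow> complex) set" where
  "L2_cnj M F = L2_class M (\<lambda>x. cnj (L2_rep F x))"

definition L2_abs :: "'x measure \<Rightarrow> ('x \<Rightarrow> complex) set \<Rightarrow> ('x \<Rightarrow> complex) set" where
  "L2_abs M F = L2_class M (\<lambda>x. complex_of_real (cmod (L2_rep F x)))"

text \<open>
  The order on complex numbers from the library is used here: \<open>z \<le> w\<close> means that
  \<open>w - z\<close> is a nonnegative real number.
\<close>

definition L2_le :: "'x measure \<Rightarrow> ('x \<Rightarrow> complex) set \<Rightarrow> ('x \<Rightarrow> complex) set \<Rightarrow> bool" where
  "L2_le M F G \<longleftrightarrow> (AE x in M. L2_rep F x \<le> L2_rep G x)"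

definition L2_pos :: "'x measure \<Rightarrow> ('x \<Rightarrow> complex) set set" where
  "L2_pos M = {F \<in> carrier (L2 M). AE x in M. 0 \<le> L2_rep F x}"

definition real_form :: "'x measure \<Rightarrow> ('x \<Rightarrow> complex) set qform \<Rightarrow> bool" where
  "real_form M q \<longleftrightarrow>
     (\<forall>f\<in>qdom q. L2_cnj M f \<in> qdom q \<and> qval q (L2_cnj M f) = qval q f)"

definition first_Beurling_Deny :: "'x measure \<Rightarrow> ('x \<Rightarrow> complex) set qform \<Rightarrow> bool" where
  "first_Beurling_Deny M q \<longleftrightarrow>
     real_form M q \<and>
     (\<forall>f\<in>qdom q. L2_abs M f \<in> qdom q \<and> qval q (L2_abs M f) \<le> qval q f)"


section \<open>Absolute pairings, ideals and domination\<close>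

definition absolute_map ::
    "('a, 'c) hilbert_scheme \<Rightarrow> 'x measure \<Rightarrow> ('a \<Rightarrow> ('x \<Rightarrow> complex) set) \<Rightarrow> bool" where
  "absolute_map H M A \<longleftrightarrow>
     (\<forall>\<xi>\<in>carrier H. A \<xi> \<in> L2_pos M) \<and>
     (\<forall>\<xi>\<in>carrier H. \<forall>\<eta>\<in>carrier H.
        complex_of_real (cmod (cinner H \<xi> \<eta>)) \<le> cinner (L2 M) (A \<xi>) (A \<eta>)) \<and>
     (\<forall>\<xi>\<in>carrier H. complex_of_real (cmod (cinner H \<xi> \<xi>)) = cinner (L2 M) (A \<xi>) (A \<xi>))"

definition paired ::
    "('a, 'c) hilbert_scheme \<Rightarrow> 'x measure \<Rightarrow> ('a \<Rightarrow> ('x \<Rightarrow> complex) set) \<Rightarrow> 'a \<Rightarrow> 'a \<Rightarrow> bool" where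
  "paired H M A \<xi> \<eta> \<longleftrightarrow> cinner H \<xi> \<eta> = cinner (L2 M) (A \<xi>) (A \<eta>)"

definition absolute_pairing ::
    "('a, 'c) hilbert_scheme \<Rightarrow> 'x measure \<Rightarrow> ('a \<Rightarrow> ('x \<Rightarrow> complex) set) \<Rightarrow> bool" where
  "absolute_pairing H M A \<longleftrightarrow>
     absolute_map H M A \<and>
     (\<forall>\<xi>\<in>carrier H. \<forall>f\<in>L2_pos M. \<exists>\<eta>\<in>carrier H. A \<eta> = f \<and> paired H M A \<xi> \<eta>)"

text \<open>
  The argument \<open>A\<close> is the modulus: the given absolute map for subspaces of the abstract Hilbert
  space, and \<^term>\<open>L2_abs M\<close> for subspaces of \<^term>\<open>L2 M\<close>.
\<close>

definition ideal_of ::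
    "('a, 'c) hilbert_scheme \<Rightarrow> 'x measure \<Rightarrow> ('a \<Rightarrow> ('x \<Rightarrow> complex) set) \<Rightarrow> 'a set \<Rightarrow> 'a set \<Rightarrow> bool"
  where
  "ideal_of H M A U V \<longleftrightarrow>
     subspace_of H U \<and> subspace_of H V \<and> U \<subseteq> V \<and>
     (\<forall>f\<in>U. \<forall>g\<in>V. L2_le M (A g) (A f) \<longrightarrow> g \<in> U)"

definition generalized_ideal_of ::
    "('a, 'c) hilbert_scheme \<Rightarrow> 'x measure \<Rightarrow> ('a \<Rightarrow> ('x \<Rightarrow> complex) set) \<Rightarrow> 'a set \<Rightarrow>
     ('x \<Rightarrow> complex) set set \<Rightarrow> bool" where
  "generalized_ideal_of H M A U V \<longleftrightarrow>
     subspace_of H U \<and> subspace_of (L2 M) V \<and>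
     (\<forall>\<xi>\<in>U. A \<xi> \<in> V \<and>
        (\<forall>f\<in>V. f \<in> L2_pos M \<and> L2_le M f (A \<xi>) \<longrightarrow> (\<exists>\<eta>\<in>U. A \<eta> = f \<and> paired H M A \<xi> \<eta>)))"

text \<open>
  The right-hand side of the inequality is the real part of a number which is real whenever
  \<open>b\<close> is a real form, in particular when \<open>b\<close> satisfies the first Beurling-Deny criterion.
\<close>

definition dominated_by ::
    "('a, 'c) hilbert_scheme \<Rightarrow> 'x measure \<Rightarrow> ('a \<Rightarrow> ('x \<Rightarrow> complex) set) \<Rightarrow> 'a qform \<Rightarrow>
     ('x \<Rightarrow> complex) set qform \<Rightarrow> bool" where
  "dominated_by H M A a b \<longleftrightarrow>
     generalized_ideal_of H M A (qdom a) (qdom b) \<and>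
     (\<forall>\<xi>\<in>qdom a. \<forall>\<eta>\<in>qdom a. paired H M A \<xi> \<eta> \<longrightarrow>
        Re (polar H a \<xi> \<eta>) \<ge> Re (polar (L2 M) b (A \<xi>) (A \<eta>)))"

end

theory Submission
  imports Defs
begin

text \<open>
  Let \<open>\<xi> \<in> D(a)\<close> and put \<open>u = |\<xi>| \<in> D(b)\<close>.  Since \<open>D\<^sub>b\<close> is a core, \<open>u\<close> is approximated in the form norm
  by elements \<open>g \<in> D\<^sub>b\<close>.  The truncation \<open>f = u \<and> |g|\<close> lies below \<open>|g|\<close>, hence in the ideal \<open>D\<^sub>b\<close>, and
  below \<open>|\<xi>|\<close>, hence it lifts to some \<open>\<eta> \<in> D(a)\<close> with \<open>|\<eta>| = f\<close> that is paired with \<open>\<xi>\<close>.  As \<open>f\<close>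
  is nonnegative and belongs to \<open>D\<^sub>b\<close> and to \<open>|D(a)|\<close>, it is by assumption also the modulus of an element
  of \<open>D\<^sub>a\<close>, and the ideal property puts \<open>\<eta>\<close> itself into \<open>D\<^sub>a\<close>.  Pairedness yields
  \<open>\<parallel>\<xi> - \<eta>\<parallel> = \<parallel>u - f\<parallel> \<le> \<parallel>u - g\<parallel>\<close>, so \<open>\<eta>\<close> is close to \<open>\<xi>\<close> in the Hilbert space.

  The remaining point is that \<open>\<eta>\<close> stays bounded in the form norm.  Because \<open>|\<eta>| \<le> |\<xi>|\<close>, the elements
  \<open>\<eta>\<close> and \<open>\<xi> - \<eta>\<close> are paired and \<open>|\<xi> - \<eta>| = u - f\<close> (\<open>paired_minus\<close>).  Domination applied to this pair
  and polarized says
  \<open>a(\<eta>) + a(\<xi> - \<eta>) \<le> a(\<xi>) + b(f) + b(u - f) - b(u)\<close> (\<open>dominated_form_estimate\<close>), and the first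
  Beurling-Deny criterion bounds \<open>b(f)\<close> by the values of \<open>b\<close> at \<open>u\<close> and \<open>g\<close> (\<open>shifted_form_meet_le\<close>).

  Boundedness in the form norm together with convergence in the Hilbert space is enough: it implies
  weak convergence in \<open>D(a)\<close>, and a subspace has the same weak and strong closure.  This last step
  (\<open>bounded_approximation_imp_form_approximation\<close>) is carried out by hand, with almost minimal
  elements of a decreasing sequence of convex sets instead of weak compactness.

  The Hilbert space norm and the form norms are estimated through their squares \<open>Q\<close>, which satisfy the
  parallelogram law.  It gives the quasi-triangle inequality \<open>Q(f + g) \<le> 2 Q(f) + 2 Q(g)\<close>, the scaling
  \<open>Q(f/2) = Q(f)/4\<close> and the Cauchy estimates, for both kinds of norms at once.
\<close>

section \<open>Inner product spaces and the parallelogram law\<close>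

lemma complex_ring_simps [simp]:
  "carrier complex_ring = UNIV" "add complex_ring = (+)" "mult complex_ring = (*)"
  "one complex_ring = 1" "zero complex_ring = 0"
  by (auto simp: ring_of_type_algebra_def)

text \<open>
  The common ground of \<open>H\<close> and \<open>L2 M\<close>: the axioms of \<open>complex_hilbert_space\<close> on which the computations
  with norms and inner products in both spaces rest.
\<close>
locale complex_inner_product_space = module complex_ring H
  for H :: "('a, 'c) hilbert_scheme" (structure) +
  assumes inner_add: "\<lbrakk>f \<in> carrier H; g \<in> carrier H; h \<in> carrier H\<rbrakk> \<Longrightarrow>
      cinner H (f \<oplus> g) h = cinner H f h + cinner H g h"
    and inner_smult: "\<lbrakk>f \<in> carrier H; g \<in> carrier H\<rbrakk> \<Longrightarrow>
      cinner H (c \<odot> f) g = c * cinner H f g"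
    and inner_commute: "\<lbrakk>f \<in> carrier H; g \<in> carrier H\<rbrakk> \<Longrightarrow>
      cinner H g f = cnj (cinner H f g)"
    and inner_nonneg: "f \<in> carrier H \<Longrightarrow> 0 \<le> cinner H f f"
    and inner_definite: "\<lbrakk>f \<in> carrier H; cinner H f f = 0\<rbrakk> \<Longrightarrow> f = \<zero>"

lemma (in complex_hilbert_space) complex_inner_product_space: "complex_inner_product_space H"
  by unfold_locales
    (auto simp: cinner_add cinner_smult cinner_nonneg cinner_definite intro: cinner_commute)

definition parallelogram_law :: "('a, 'c) hilbert_scheme \<Rightarrow> 'a set \<Rightarrow> ('a \<Rightarrow> real) \<Rightarrow> bool" where
  "parallelogram_law H D Q \<longleftrightarrow>
     (\<forall>f\<in>D. \<forall>g\<in>D. Q (f \<oplus>\<^bsub>H\<^esub> g) + Q (f \<ominus>\<^bsub>H\<^esub> g) = 2 * Q f + 2 * Q g)"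

context complex_inner_product_space
begin

lemma uminus_eq_smult: "f \<in> carrier H \<Longrightarrow> \<ominus> f = (-1) \<odot> f"
  using smult_l_distr[of "-1" 1 f] smult_one[of f] smult_l_null[of f] minus_equality[of "(-1) \<odot> f" f]
  by simp

lemma minus_eq_smult: "\<lbrakk>f \<in> carrier H; g \<in> carrier H\<rbrakk> \<Longrightarrow> f \<ominus> g = f \<oplus> (-1) \<odot> g"
  by (simp add: a_minus_def uminus_eq_smult)

lemma smult_smult: "f \<in> carrier H \<Longrightarrow> c \<odot> (d \<odot> f) = (c * d) \<odot> f"
  using smult_assoc1[of c d f] by simp

lemma smult_in_carrier: "f \<in> carrier H \<Longrightarrow> c \<odot> f \<in> carrier H"
  by (rule smult_closed) auto

lemma smult_add_left: "f \<in> carrier H \<Longrightarrow> (c + d) \<odot> f = c \<odot> f \<oplus> d \<odot> f"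
  using smult_l_distr[of c d f] by simp

lemma smult_add_right: "f \<in> carrier H \<Longrightarrow> g \<in> carrier H \<Longrightarrow> c \<odot> (f \<oplus> g) = c \<odot> f \<oplus> c \<odot> g"
  using smult_r_distr[of c f g] by simp

lemma smult_unit: "f \<in> carrier H \<Longrightarrow> 1 \<odot> f = f"
  using smult_one[of f] by simp

lemma half_add_half: "f \<in> carrier H \<Longrightarrow> (1/2) \<odot> f \<oplus> (1/2) \<odot> f = f"
  using smult_add_left[of f "1/2" "1/2"] by (simp add: smult_unit)

lemma add_minus_cancel: "\<lbrakk>f \<in> carrier H; g \<in> carrier H\<rbrakk> \<Longrightarrow> f \<oplus> (g \<ominus> f) = g"
  using M.a_comm[of g "\<ominus> f"] by (simp add: a_minus_def M.r_neg2)

lemma minus_minus_cancel: "\<lbrakk>f \<in> carrier H; g \<in> carrier H\<rbrakk> \<Longrightarrow> f \<ominus> (f \<ominus> g) = g"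
  by (simp add: a_minus_def M.minus_add M.r_neg2)

lemma subspace_closed:
  assumes "subspace_of H D"
  shows "f \<in> D \<Longrightarrow> f \<in> carrier H" "\<zero> \<in> D"
    and "f \<in> D \<Longrightarrow> g \<in> D \<Longrightarrow> f \<oplus> g \<in> D"
    and "f \<in> D \<Longrightarrow> c \<odot> f \<in> D"
    and "f \<in> D \<Longrightarrow> g \<in> D \<Longrightarrow> f \<ominus> g \<in> D"
proof -
  show "\<zero> \<in> D"
    using subgroup.one_closed[OF submodule.axioms(1)[OF assms]] by simp
qed (use submoduleE[OF assms] in \<open>auto simp: a_minus_def\<close>)

text \<open>
  The mixed terms cancel in the sum, whatever the signs of \<open>B f f\<close> and \<open>B g g\<close>; so inner products and
  lower bounded forms are covered alike.
\<close>
lemma sesquilinear_parallelogram: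
  assumes "subspace_of H D" "sesquilinear_on H D B"
  shows "parallelogram_law H D (\<lambda>f. Re (B f f))"
proof -
  have "Re (B (f \<oplus> g) (f \<oplus> g)) + Re (B (f \<ominus> g) (f \<ominus> g)) = 2 * Re (B f f) + 2 * Re (B g g)"
    if fg: "f \<in> D" "g \<in> D" for f g
  proof -
    note cl = subspace_closed[OF assms(1)]
    have B: "B (f \<oplus> g) h = B f h + B g h" "B (c \<odot> f) h = c * B f h"
       "B h (f \<oplus> g) = B h f + B h g" "B h (c \<odot> f) = cnj c * B h f"
      if "f \<in> D" "g \<in> D" "h \<in> D" for f g h c
      using assms(2) that unfolding sesquilinear_on_def by blast+
    have m: "f \<ominus> g = f \<oplus> (-1) \<odot> g"
      using fg by (simp add: minus_eq_smult cl(1))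
    show ?thesis
      unfolding m using fg by (simp add: B cl)
  qed
  then show ?thesis
    by (simp add: parallelogram_law_def)
qed

lemma cinner_sesquilinear: "sesquilinear_on H (carrier H) (cinner H)"
proof -
  have r: "cinner H h (f \<oplus> g) = cinner H h f + cinner H h g"
    if "f \<in> carrier H" "g \<in> carrier H" "h \<in> carrier H" for f g h
    using that inner_commute[of "f \<oplus> g" h] inner_commute[of f h] inner_commute[of g h]
    by (simp add: inner_add)
  have s: "cinner H h (c \<odot> f) = cnj c * cinner H h f"
    if "f \<in> carrier H" "h \<in> carrier H" for f h c
    using that inner_commute[of "c \<odot> f" h] inner_commute[of f h]
    by (simp add: inner_smult smult_in_carrier)
  show ?thesis
    unfolding sesquilinear_on_def by (simp add: inner_add inner_smult r s)
qed

lemma cinner_minus_right: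
  assumes "f \<in> carrier H" "g \<in> carrier H" "h \<in> carrier H"
  shows "cinner H h (f \<ominus> g) = cinner H h f - cinner H h g"
proof -
  have "cinner H h (f \<oplus> (-1) \<odot> g) = cinner H h f + cinner H h ((-1) \<odot> g)"
    "cinner H h ((-1) \<odot> g) = cnj (-1) * cinner H h g"
    using cinner_sesquilinear assms smult_in_carrier[OF assms(2), of "-1"]
    unfolding sesquilinear_on_def by blast+
  then show ?thesis
    by (simp add: minus_eq_smult[OF assms(1,2)])
qed

lemma hnorm_square: "f \<in> carrier H \<Longrightarrow> (hnorm H f)\<^sup>2 = Re (cinner H f f)"
  using inner_nonneg[of f] by (simp add: hnorm_def less_eq_complex_def)

lemma hnorm_parallelogram: "parallelogram_law H (carrier H) (\<lambda>f. (hnorm H f)\<^sup>2)"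
  using sesquilinear_parallelogram[OF carrier_is_submodule cinner_sesquilinear]
  by (simp add: parallelogram_law_def hnorm_square)

lemma hnorm_minus_square:
  assumes "f \<in> carrier H" "g \<in> carrier H"
  shows "(hnorm H (f \<ominus> g))\<^sup>2 = (hnorm H f)\<^sup>2 - 2 * Re (cinner H f g) + (hnorm H g)\<^sup>2"
proof -
  have B: "cinner H (f \<oplus> g) h = cinner H f h + cinner H g h" "cinner H (c \<odot> f) h = c * cinner H f h"
       "cinner H h (f \<oplus> g) = cinner H h f + cinner H h g" "cinner H h (c \<odot> f) = cnj c * cinner H h f"
      if "f \<in> carrier H" "g \<in> carrier H" "h \<in> carrier H" for f g h c
      using cinner_sesquilinear that unfolding sesquilinear_on_def by blast+
  show ?thesis
    using assms inner_commute[of f g]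
    by (simp add: hnorm_square minus_eq_smult B smult_in_carrier)
qed

lemma zero_if_hnorm_zero: "f \<in> carrier H \<Longrightarrow> (hnorm H f)\<^sup>2 = 0 \<Longrightarrow> f = \<zero>"
  using inner_nonneg[of f] inner_definite[of f]
  by (simp add: hnorm_square less_eq_complex_def complex_eq_iff)

lemma eq_if_hnorm_minus_zero:
  "f \<in> carrier H \<Longrightarrow> g \<in> carrier H \<Longrightarrow> (hnorm H (f \<ominus> g))\<^sup>2 = 0 \<Longrightarrow> f = g"
  using zero_if_hnorm_zero[of "f \<ominus> g"] M.minus_equality[of f "\<ominus> g"]
  by (simp add: a_minus_def)

text \<open>
  The parallelogram law, specialized to the pairs \<open>0, 0\<close> and \<open>0, f - g\<close> and \<open>f/2, f/2\<close>, supplies the scaling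
  properties of a quadratic form in this lemma and the two after it.
\<close>
lemma parallelogram_zero:
  assumes "subspace_of H D" "parallelogram_law H D Q"
  shows "Q \<zero> = 0"
proof -
  have "Q (\<zero> \<oplus> \<zero>) + Q (\<zero> \<ominus> \<zero>) = 2 * Q \<zero> + 2 * Q \<zero>"
    using assms subspace_closed(2)[OF assms(1)] unfolding parallelogram_law_def by blast
  moreover have "\<zero> \<ominus> \<zero> = \<zero>"
    by (simp add: a_minus_def)
  ultimately show ?thesis by simp
qed

lemma parallelogram_minus_commute:
  assumes "subspace_of H D" "parallelogram_law H D Q" "f \<in> D" "g \<in> D"
  shows "Q (g \<ominus> f) = Q (f \<ominus> g)"
proof -
  note cl = subspace_closed[OF assms(1)]
  have "Q (\<zero> \<oplus> (f \<ominus> g)) + Q (\<zero> \<ominus> (f \<ominus> g)) = 2 * Q \<zero> + 2 * Q (f \<ominus> g)"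
    using assms cl unfolding parallelogram_law_def by blast
  moreover have "\<zero> \<ominus> (f \<ominus> g) = g \<ominus> f"
    using assms cl(1) by (simp add: a_minus_def minus_add M.a_comm)
  ultimately show ?thesis
    using parallelogram_zero[OF assms(1,2)] assms cl(1) by simp
qed

lemma parallelogram_half:
  assumes "subspace_of H D" "parallelogram_law H D Q" "f \<in> D"
  shows "Q ((1/2) \<odot> f) = Q f / 4"
proof -
  note cl = subspace_closed[OF assms(1)]
  let ?h = "(1/2) \<odot> f"
  have "Q (?h \<oplus> ?h) + Q (?h \<ominus> ?h) = 2 * Q ?h + 2 * Q ?h"
    using assms cl unfolding parallelogram_law_def by blast
  moreover have "?h \<ominus> ?h = \<zero>"
    using smult_in_carrier[OF cl(1)[OF assms(3)]] by (simp add: a_minus_def M.r_neg)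
  ultimately show ?thesis
    using parallelogram_zero[OF assms(1,2)] half_add_half[OF cl(1)[OF assms(3)]] by simp
qed

text \<open>
  A substitute for the triangle inequality: one of the two nonnegative summands is dropped in the
  parallelogram law.
\<close>
lemma parallelogram_le:
  assumes "subspace_of H D" "parallelogram_law H D Q" "\<And>h. h \<in> D \<Longrightarrow> 0 \<le> Q h" "f \<in> D" "g \<in> D"
  shows "Q (f \<oplus> g) \<le> 2 * Q f + 2 * Q g" "Q (f \<ominus> g) \<le> 2 * Q f + 2 * Q g"
proof -
  have "Q (f \<oplus> g) + Q (f \<ominus> g) = 2 * Q f + 2 * Q g"
    using assms(2,4,5) unfolding parallelogram_law_def by blast
  moreover have "0 \<le> Q (f \<oplus> g)" "0 \<le> Q (f \<ominus> g)"
    using subspace_closed(3,5)[OF assms(1,4,5)] by (simp_all add: assms(3))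
  ultimately show "Q (f \<oplus> g) \<le> 2 * Q f + 2 * Q g" "Q (f \<ominus> g) \<le> 2 * Q f + 2 * Q g"
    by linarith+
qed

lemma parallelogram_le_minus:
  assumes "subspace_of H D" "parallelogram_law H D Q" "\<And>h. h \<in> D \<Longrightarrow> 0 \<le> Q h" "f \<in> D" "g \<in> D"
  shows "Q g \<le> 2 * Q f + 2 * Q (f \<ominus> g)"
  using parallelogram_le(2)[OF assms(1-4) subspace_closed(5)[OF assms(1,4,5)]]
    minus_minus_cancel[of f g] assms(4,5) subspace_closed(1)[OF assms(1)] by simp

end

section \<open>Quadratic forms and shifted forms\<close>

context complex_inner_product_space
begin

lemma qval_parallelogram:
  assumes "quadratic_form H q"
  shows "parallelogram_law H (qdom q) (qval q)"
proof -
  have D: "subspace_of H (qdom q)" and S: "sesquilinear_on H (qdom q) (polar H q)"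
    and d: "\<And>f. f \<in> qdom q \<Longrightarrow> qval q f = Re (polar H q f f)"
    using assms unfolding quadratic_form_def by auto
  show ?thesis
    using sesquilinear_parallelogram[OF D S] d subspace_closed[OF D]
    unfolding parallelogram_law_def by simp
qed

text \<open>
  The terms of the polarization sum with \<open>k = 1\<close> and \<open>k = 3\<close> are purely imaginary, the other two
  give \<open>4 Re q(f,g) = q(f + g) - q(f - g)\<close>, and the parallelogram law removes \<open>q(f - g)\<close>.
\<close>
lemma Re_polar:
  assumes "quadratic_form H q" "f \<in> qdom q" "g \<in> qdom q"
  shows "2 * Re (polar H q f g) = qval q (f \<oplus> g) - qval q f - qval q g"
proof -
  have D: "subspace_of H (qdom q)"
    using assms unfolding quadratic_form_def by auto
  note cl = subspace_closed[OF D]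
  have "{1..4::nat} = {1,2,3,4}" by auto
  moreover have "\<i> ^ 3 = - \<i>" "\<i> ^ 4 = 1"
    by (auto simp: eval_nat_numeral)
  ultimately have "4 * Re (polar H q f g) = qval q (f \<oplus> g) - qval q (f \<oplus> (-1) \<odot> g)"
    using assms cl(1) by (simp add: polar_def smult_unit)
  moreover have "f \<oplus> (-1) \<odot> g = f \<ominus> g"
    using assms cl(1) by (simp add: minus_eq_smult)
  moreover have "qval q (f \<oplus> g) + qval q (f \<ominus> g) = 2 * qval q f + 2 * qval q g"
    using qval_parallelogram[OF assms(1)] assms(2,3) unfolding parallelogram_law_def by blast
  ultimately show ?thesis by simp
qed

end

text \<open>
  The square of the form norm, which unlike the norm itself satisfies the parallelogram law.
\<close>
definition shifted_form :: "('a, 'c) hilbert_scheme \<Rightarrow> 'a qform \<Rightarrow> real \<Rightarrow> 'a \<Rightarrow> real" where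
  "shifted_form H q \<mu> f = qval q f + \<mu> * (hnorm H f)\<^sup>2"

lemma form_norm_eq: "form_norm H q \<mu> f = sqrt (shifted_form H q \<mu> f)"
  by (simp add: form_norm_def shifted_form_def)

text \<open>
  The form norm controls the norm of the Hilbert space; \<open>c\<close> is the gap between \<open>\<mu>\<close> and a number
  whose negative is a lower bound of the form.
\<close>
lemma form_shift_bound:
  assumes "form_shift H q \<mu>"
  obtains c where "c > 0" "\<And>f. f \<in> qdom q \<Longrightarrow> c * (hnorm H f)\<^sup>2 \<le> shifted_form H q \<mu> f"
proof -
  obtain l where l: "\<mu> > l" "\<And>f. f \<in> qdom q \<Longrightarrow> qval q f \<ge> - l * (hnorm H f)\<^sup>2"
    using assms unfolding form_shift_def by blast
  show ?thesis
  proof (rule that[of "\<mu> - l"])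
    show "(\<mu> - l) * (hnorm H f)\<^sup>2 \<le> shifted_form H q \<mu> f" if "f \<in> qdom q" for f
      using l(2)[OF that] by (simp add: shifted_form_def left_diff_distrib)
  qed (use l(1) in simp)
qed

lemma form_shift_nonneg:
  assumes "form_shift H q \<mu>" "f \<in> qdom q"
  shows "0 \<le> shifted_form H q \<mu> f"
proof -
  obtain c where "c > 0" "\<And>f. f \<in> qdom q \<Longrightarrow> c * (hnorm H f)\<^sup>2 \<le> shifted_form H q \<mu> f"
    using form_shift_bound[OF assms(1)] by blast
  moreover from this(1) have "0 \<le> c * (hnorm H f)\<^sup>2"
    by simp
  ultimately show ?thesis
    using assms(2) by (blast intro: order_trans)
qed

context complex_inner_product_space
begin

lemma shifted_form_parallelogram:
  assumes "quadratic_form H q"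
  shows "parallelogram_law H (qdom q) (shifted_form H q \<mu>)"
proof -
  have D: "subspace_of H (qdom q)"
    using assms unfolding quadratic_form_def by auto
  have "shifted_form H q \<mu> (f \<oplus> g) + shifted_form H q \<mu> (f \<ominus> g)
      = 2 * shifted_form H q \<mu> f + 2 * shifted_form H q \<mu> g" if "f \<in> qdom q" "g \<in> qdom q" for f g
  proof -
    have "qval q (f \<oplus> g) + qval q (f \<ominus> g) = 2 * qval q f + 2 * qval q g"
      using qval_parallelogram[OF assms(1)] that unfolding parallelogram_law_def by blast
    moreover have "(hnorm H (f \<oplus> g))\<^sup>2 + (hnorm H (f \<ominus> g))\<^sup>2 = 2 * (hnorm H f)\<^sup>2 + 2 * (hnorm H g)\<^sup>2"
      using hnorm_parallelogram that subspace_closed(1)[OF D] unfolding parallelogram_law_def by blast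
    then have "\<mu> * (hnorm H (f \<oplus> g))\<^sup>2 + \<mu> * (hnorm H (f \<ominus> g))\<^sup>2 = \<mu> * (2 * (hnorm H f)\<^sup>2 + 2 * (hnorm H g)\<^sup>2)"
      by (subst distrib_left[symmetric]) simp
    ultimately show ?thesis
      unfolding shifted_form_def by (simp add: algebra_simps)
  qed
  then show ?thesis unfolding parallelogram_law_def by blast
qed

text \<open>
  An elementary form of Mazur's theorem.  The sets \<open>S n\<close> of all \<open>g \<in> U\<close> with \<open>\<parallel>g - \<xi>\<parallel>\<^sup>2 < 1/(n+1)\<close> are
  midpoint convex and decreasing, and the infima of the squared form norm over them are bounded by \<open>C\<close>,
  hence convergent.  By the parallelogram law almost minimal elements of \<open>S n\<close> form a Cauchy
  sequence in the form norm; as they converge to \<open>\<xi>\<close> in \<open>H\<close>, their limit in the form domain is \<open>\<xi>\<close>.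
\<close>
lemma bounded_approximation_imp_form_approximation:
  assumes q: "closed_form H q \<mu>" and U: "subspace_of H U" "U \<subseteq> qdom q" and \<xi>: "\<xi> \<in> qdom q"
    and approx: "\<And>e. e > 0 \<Longrightarrow> \<exists>g\<in>U. (hnorm H (g \<ominus> \<xi>))\<^sup>2 < e \<and> shifted_form H q \<mu> g \<le> C"
    and e: "e > 0"
  shows "\<exists>g\<in>U. form_norm H q \<mu> (\<xi> \<ominus> g) < e"
proof -
  define Q where "Q = shifted_form H q \<mu>"
  define n2 where "n2 = (\<lambda>f. (hnorm H f)\<^sup>2)"
  have qf: "quadratic_form H q" and shift: "form_shift H q \<mu>"
    and compl: "complete_wrt H (form_norm H q \<mu>) (qdom q)"
    using q unfolding closed_form_def by auto
  have D: "subspace_of H (qdom q)"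
    using qf unfolding quadratic_form_def by auto
  note cl = subspace_closed[OF D] and clU = subspace_closed[OF U(1)]
  have Q: "parallelogram_law H (qdom q) Q"
    unfolding Q_def using qf by (rule shifted_form_parallelogram)
  have n2: "parallelogram_law H (carrier H) n2"
    unfolding n2_def by (rule hnorm_parallelogram)
  have car: "subspace_of H (carrier H)"
    by (rule carrier_is_submodule)
  have Q0: "0 \<le> Q f" if "f \<in> qdom q" for f
    unfolding Q_def using shift that by (rule form_shift_nonneg)
  have n0: "0 \<le> n2 f" for f
    by (simp add: n2_def)
  obtain c where c: "c > 0" "\<And>f. f \<in> qdom q \<Longrightarrow> c * n2 f \<le> Q f"
    using form_shift_bound[OF shift] unfolding Q_def n2_def by blast
  define S where "S n = {g \<in> U. n2 (g \<ominus> \<xi>) < 1 / Suc n}" for n :: nat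
  define r where "r n = Inf (Q ` S n)" for n
  have SU: "S n \<subseteq> U" for n
    by (auto simp: S_def)
  have Santi: "S m \<subseteq> S n" if "n \<le> m" for m n
  proof -
    have "1 / Suc m \<le> 1 / Suc n"
      using that by (simp add: frac_le)
    then show ?thesis
      by (auto simp: S_def)
  qed
  have bdd: "bdd_below (Q ` S n)" for n
    using Q0 SU U(2) by (intro bdd_belowI[of _ 0]) auto
  have Sne: "\<exists>g\<in>S n. Q g \<le> C" for n
    using approx[of "1 / Suc n"] by (auto simp: S_def Q_def n2_def)
  have rle: "r n \<le> Q g" if "g \<in> S n" for n g
    unfolding r_def using that bdd by (intro cInf_lower) auto
  have rC: "r n \<le> C" for n
    using Sne[of n] rle by force
  have rmono: "r n \<le> r m" if "n \<le> m" for m n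
    unfolding r_def using Santi[OF that] Sne[of m] bdd by (intro cInf_superset_mono) auto
  have "\<exists>g\<in>S n. Q g < r n + 1 / Suc n" for n
  proof -
    have "Q ` S n \<noteq> {}"
      using Sne[of n] by auto
    then have "\<exists>y\<in>Q ` S n. y < r n + 1 / Suc n"
      by (intro cInf_lessD) (auto simp: r_def)
    then show ?thesis by auto
  qed
  then obtain z where z: "\<And>n. z n \<in> S n" "\<And>n. Q (z n) < r n + 1 / Suc n"
    by metis
  have zU: "z n \<in> U" for n
    using z(1)[of n] by (simp add: S_def)
  have zD: "z n \<in> qdom q" for n
    using zU U(2) by blast
  have mid: "(1/2) \<odot> (f \<oplus> g) \<in> S n" if "f \<in> S n" "g \<in> S n" for f g n
  proof -
    have fg: "f \<in> U" "g \<in> U" "n2 (f \<ominus> \<xi>) < 1 / Suc n" "n2 (g \<ominus> \<xi>) < 1 / Suc n"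
      using that by (auto simp: S_def)
    have fc: "f \<in> carrier H" "g \<in> carrier H" "\<xi> \<in> carrier H"
      using fg clU(1) cl(1) \<xi> by auto
    have "(1/2) \<odot> (f \<oplus> g) \<ominus> \<xi> = (1/2) \<odot> ((f \<ominus> \<xi>) \<oplus> (g \<ominus> \<xi>))"
    proof -
      have "(1/2) \<odot> ((f \<ominus> \<xi>) \<oplus> (g \<ominus> \<xi>)) = (1/2) \<odot> (f \<oplus> g) \<oplus> (-1) \<odot> ((1/2) \<odot> \<xi> \<oplus> (1/2) \<odot> \<xi>)"
        using fc by (simp add: minus_eq_smult smult_add_right smult_smult smult_in_carrier M.a_ac)
      then show ?thesis
        using fc by (simp add: half_add_half minus_eq_smult smult_in_carrier)
    qed
    then have "n2 ((1/2) \<odot> (f \<oplus> g) \<ominus> \<xi>) = n2 ((f \<ominus> \<xi>) \<oplus> (g \<ominus> \<xi>)) / 4"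
      using parallelogram_half[OF car n2] fc by simp
    also have "\<dots> \<le> (2 * n2 (f \<ominus> \<xi>) + 2 * n2 (g \<ominus> \<xi>)) / 4"
      using parallelogram_le(1)[OF car n2 n0] fc by simp
    also have "\<dots> < 1 / Suc n"
      using fg by simp
    finally show ?thesis
      using fg clU by (simp add: S_def)
  qed
  have close: "Q (z m \<ominus> z n) \<le> 2 * \<bar>r m - r n\<bar> + 4 / Suc n" if "n \<le> m" for m n
  proof -
    have "z m \<in> S n"
      using z(1) Santi[OF that] by blast
    then have "r n \<le> Q ((1/2) \<odot> (z m \<oplus> z n))"
      using mid z(1) rle by blast
    also have "\<dots> = Q (z m \<oplus> z n) / 4"
      using parallelogram_half[OF D Q] zD cl by simp
    finally have h1: "4 * r n \<le> Q (z m \<oplus> z n)" by simp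
    have h2: "Q (z m \<oplus> z n) + Q (z m \<ominus> z n) = 2 * Q (z m) + 2 * Q (z n)"
      using Q zD unfolding parallelogram_law_def by blast
    have h3: "(1::real) / Suc m \<le> 1 / Suc n"
      using that by (simp add: frac_le)
    have four: "4 / real (Suc n) = 4 * (1 / real (Suc n))"
      by simp
    have arith: "x \<le> 2 * \<bar>a - b\<bar> + 4 * v"
      if "4 * b \<le> y" "y + x = 2 * p + 2 * p'" "u \<le> v" "p < a + u" "p' < b + v"
      for a b p p' u v x y :: real
    proof -
      have "x \<le> 2 * (a - b) + 4 * v"
        using that by simp
      also have "\<dots> \<le> 2 * \<bar>a - b\<bar> + 4 * v"
        using abs_ge_self[of "a - b"] by simp
      finally show ?thesis .
    qed
    show ?thesis
      unfolding four by (rule arith[OF h1 h2 h3 z(2) z(2)])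
  qed
  have "Cauchy r"
  proof -
    have "incseq r"
      using rmono by (simp add: incseq_def)
    moreover have "\<forall>n. r n \<le> C"
      using rC by blast
    ultimately have "\<exists>L. r \<longlonglongrightarrow> L"
      by (rule incseq_convergent) (rule exI)
    then show ?thesis
      using LIMSEQ_imp_Cauchy by blast
  qed
  have "\<exists>n0. \<forall>m\<ge>n0. \<forall>n\<ge>n0. form_norm H q \<mu> (z m \<ominus> z n) < d" if d: "d > 0" for d
  proof -
    have d2: "d\<^sup>2 / 8 > 0"
      using d by simp
    obtain n1 where n1: "\<And>m n. m \<ge> n1 \<Longrightarrow> n \<ge> n1 \<Longrightarrow> \<bar>r m - r n\<bar> < d\<^sup>2 / 8"
      using CauchyD[OF \<open>Cauchy r\<close> d2] by auto
    obtain k where k: "inverse (real (Suc k)) < d\<^sup>2 / 8"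
      using reals_Archimedean[OF d2] by blast
    have tail: "4 / real (Suc n) < d\<^sup>2 / 2" if "n \<ge> k" for n
    proof -
      have "inverse (real (Suc n)) \<le> inverse (real (Suc k))"
        by (rule le_imp_inverse_le) (use that in simp_all)
      then have "inverse (real (Suc n)) < d\<^sup>2 / 8"
        using k by (rule order.strict_trans1)
      then have "4 * inverse (real (Suc n)) < 4 * (d\<^sup>2 / 8)"
        by (rule mult_strict_left_mono) simp
      then show ?thesis
        unfolding divide_inverse[of 4 "real (Suc n)"] by simp
    qed
    have less: "Q (z m \<ominus> z n) < d\<^sup>2" if "m \<ge> max n1 k" "n \<ge> max n1 k" "n \<le> m" for m n
    proof -
      have "\<bar>r m - r n\<bar> < d\<^sup>2 / 8" "4 / real (Suc n) < d\<^sup>2 / 2"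
        using n1[of m n] tail[of n] that by simp_all
      moreover have "x < y" if "u < y / 8" "v < y / 2" "x \<le> 2 * u + v" "0 \<le> y" for u v x y :: real
        using that by linarith
      ultimately show ?thesis
        using close[OF that(3)] zero_le_power2[of d] by blast
    qed
    have "Q (z m \<ominus> z n) < d\<^sup>2" if "m \<ge> max n1 k" "n \<ge> max n1 k" for m n
    proof (cases "n \<le> m")
      case True
      then show ?thesis
        using less that by blast
    next
      case False
      then have "Q (z n \<ominus> z m) < d\<^sup>2"
        using less[of n m] that by simp
      then show ?thesis
        using parallelogram_minus_commute[OF D Q zD zD, of m n] by simp
    qed
    then have "form_norm H q \<mu> (z m \<ominus> z n) < d" if "m \<ge> max n1 k" "n \<ge> max n1 k" for m n
      using that d real_less_lsqrt[of d "Q (z m \<ominus> z n)"] by (simp add: form_norm_eq Q_def real_less_lsqrt)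
    then show ?thesis
      by blast
  qed
  then obtain l where l: "l \<in> qdom q" "(\<lambda>n. form_norm H q \<mu> (z n \<ominus> l)) \<longlonglongrightarrow> 0"
    using compl zD unfolding complete_wrt_def by blast
  have "(\<lambda>n. Q (z n \<ominus> l)) \<longlonglongrightarrow> 0"
  proof -
    have "(form_norm H q \<mu> (z n \<ominus> l))\<^sup>2 = Q (z n \<ominus> l)" for n
      using Q0[of "z n \<ominus> l"] zD l(1) cl(5) by (simp add: form_norm_eq Q_def)
    then show ?thesis
      using tendsto_power[OF l(2), of 2] by simp
  qed
  moreover have "(\<lambda>n. 1 / real (Suc n)) \<longlonglongrightarrow> 0"
    by (rule LIMSEQ_Suc[OF lim_1_over_n])
  ultimately have lim: "(\<lambda>n. 2 * (1 / real (Suc n)) + 2 * (Q (z n \<ominus> l) / c)) \<longlonglongrightarrow> 2 * 0 + 2 * (0 / c)"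
    using c(1) by (intro tendsto_intros) auto
  \<comment> \<open>The form limit \<open>l\<close> and the limit \<open>\<xi>\<close> in \<open>H\<close> agree.\<close>
  have le: "n2 (l \<ominus> \<xi>) \<le> 2 * (1 / real (Suc n)) + 2 * (Q (z n \<ominus> l) / c)" for n
  proof -
    have in_carrier: "z n \<in> carrier H" "l \<in> carrier H" "\<xi> \<in> carrier H"
      using zD l(1) \<xi> cl(1) by auto
    have "(z n \<ominus> \<xi>) \<ominus> (z n \<ominus> l) = (l \<ominus> \<xi>) \<oplus> (z n \<ominus> z n)"
      using in_carrier by (simp add: a_minus_def minus_add M.a_ac)
    then have "l \<ominus> \<xi> = (z n \<ominus> \<xi>) \<ominus> (z n \<ominus> l)"
      using in_carrier by (simp add: a_minus_def M.r_neg)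
    then have "n2 (l \<ominus> \<xi>) \<le> 2 * n2 (z n \<ominus> \<xi>) + 2 * n2 (z n \<ominus> l)"
      using parallelogram_le(2)[OF car n2 n0] in_carrier by simp
    moreover have "n2 (z n \<ominus> \<xi>) < 1 / Suc n"
      using z(1)[of n] by (simp add: S_def)
    moreover have "n2 (z n \<ominus> l) \<le> Q (z n \<ominus> l) / c"
      using c(1) c(2)[of "z n \<ominus> l"] zD l(1) cl(5) by (simp add: pos_le_divide_eq mult.commute)
    ultimately show ?thesis by linarith
  qed
  have "n2 (l \<ominus> \<xi>) \<le> 0"
    using LIMSEQ_le_const[OF lim, of "n2 (l \<ominus> \<xi>)"] le by auto
  then have "n2 (l \<ominus> \<xi>) = 0"
    using n0[of "l \<ominus> \<xi>"] by simp
  then have "l = \<xi>"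
    using eq_if_hnorm_minus_zero[of l \<xi>] l(1) \<xi> cl(1) by (simp add: n2_def)
  then have "\<forall>\<^sub>F n in sequentially. form_norm H q \<mu> (z n \<ominus> \<xi>) < e"
    using order_tendstoD(2)[OF l(2)] e by simp
  then obtain n where "form_norm H q \<mu> (z n \<ominus> \<xi>) < e"
    by (auto simp: eventually_sequentially)
  then have "form_norm H q \<mu> (\<xi> \<ominus> z n) < e"
    using parallelogram_minus_commute[OF D Q \<xi> zD] by (simp add: form_norm_eq Q_def)
  then show ?thesis
    using zU by blast
qed

end

section \<open>Square integrable functions\<close>

lemma L2_fun_measurable [measurable_dest]: "f \<in> L2_fun M \<Longrightarrow> f \<in> borel_measurable M"
  by (simp add: L2_fun_def)

lemma L2_fun_integrable_square: "f \<in> L2_fun M \<Longrightarrow> integrable M (\<lambda>x. (cmod (f x))\<^sup>2)"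
  by (simp add: L2_fun_def)

lemma L2_fun_dominated:
  assumes "h \<in> borel_measurable M" "integrable M g" "\<And>x. (cmod (h x))\<^sup>2 \<le> g x"
  shows "h \<in> L2_fun M"
proof -
  have "integrable M (\<lambda>x. (cmod (h x))\<^sup>2)"
    by (rule Bochner_Integration.integrable_bound[OF assms(2)])
      (use assms in \<open>auto intro!: AE_I2 order_trans[OF _ abs_ge_self]\<close>)
  then show ?thesis
    using assms(1) by (simp add: L2_fun_def)
qed

lemma L2_fun_add:
  assumes "f \<in> L2_fun M" "g \<in> L2_fun M"
  shows "(\<lambda>x. f x + g x) \<in> L2_fun M"
proof (rule L2_fun_dominated)
  show "integrable M (\<lambda>x. 2 * (cmod (f x))\<^sup>2 + 2 * (cmod (g x))\<^sup>2)"
    by (intro Bochner_Integration.integrable_add integrable_mult_right L2_fun_integrable_square assms)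
  show "(cmod (f x + g x))\<^sup>2 \<le> 2 * (cmod (f x))\<^sup>2 + 2 * (cmod (g x))\<^sup>2" for x
  proof -
    have "(cmod (f x + g x))\<^sup>2 \<le> (cmod (f x) + cmod (g x))\<^sup>2"
      by (simp add: power_mono norm_triangle_ineq)
    also have "\<dots> \<le> 2 * (cmod (f x))\<^sup>2 + 2 * (cmod (g x))\<^sup>2"
      using zero_le_power2[of "cmod (f x) - cmod (g x)"] by (simp add: power2_eq_square algebra_simps)
    finally show ?thesis .
  qed
qed (use assms in measurable)

lemma L2_fun_cmult: "f \<in> L2_fun M \<Longrightarrow> (\<lambda>x. c * f x) \<in> L2_fun M"
  by (auto simp: L2_fun_def norm_mult power_mult_distrib)

lemma L2_fun_zero: "(\<lambda>x. 0) \<in> L2_fun M"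
  by (simp add: L2_fun_def)

lemma L2_fun_cmod: "f \<in> L2_fun M \<Longrightarrow> (\<lambda>x. complex_of_real (cmod (f x))) \<in> L2_fun M"
  by (auto simp: L2_fun_def)

lemma L2_fun_inner_integrable:
  assumes "f \<in> L2_fun M" "g \<in> L2_fun M"
  shows "integrable M (\<lambda>x. f x * cnj (g x))"
proof (rule Bochner_Integration.integrable_bound)
  show "integrable M (\<lambda>x. (cmod (f x))\<^sup>2 + (cmod (g x))\<^sup>2)"
    by (intro Bochner_Integration.integrable_add L2_fun_integrable_square assms)
  have "cmod (f x) * cmod (g x) \<le> (cmod (f x))\<^sup>2 + (cmod (g x))\<^sup>2" for x
  proof -
    have "0 \<le> cmod (f x) * cmod (g x)"
      by simp
    then show ?thesis
      using sum_squares_bound[of "cmod (f x)" "cmod (g x)"] by linarith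
  qed
  then show "AE x in M. norm (f x * cnj (g x)) \<le> norm ((cmod (f x))\<^sup>2 + (cmod (g x))\<^sup>2)"
    by (simp add: norm_mult)
  have "(\<lambda>x. cnj (g x)) \<in> borel_measurable M"
    using measurable_compose[OF L2_fun_measurable[OF assms(2)] borel_measurable_continuous_onI[of cnj]]
    by (simp add: continuous_on_cnj)
  then show "(\<lambda>x. f x * cnj (g x)) \<in> borel_measurable M"
    using L2_fun_measurable[OF assms(1)] by measurable
qed

lemma equiv_L2_rel: "equiv (L2_fun M) (L2_rel M)"
proof (rule equivI)
  show "refl_on (L2_fun M) (L2_rel M)" "L2_rel M \<subseteq> L2_fun M \<times> L2_fun M"
    by (auto simp: L2_rel_def refl_on_def)
  show "sym (L2_rel M)" by (auto simp: L2_rel_def sym_def elim: eventually_mono)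
  show "trans (L2_rel M)" unfolding trans_def L2_rel_def by (auto elim: eventually_elim2)
qed

lemma L2_class_in_carrier: "f \<in> L2_fun M \<Longrightarrow> L2_class M f \<in> carrier (L2 M)"
  by (simp add: L2_def L2_class_def quotientI)

lemma
  assumes "F \<in> carrier (L2 M)"
  shows L2_rep_in_L2_fun: "L2_rep F \<in> L2_fun M" and L2_class_L2_rep: "L2_class M (L2_rep F) = F"
proof -
  obtain f where f: "f \<in> L2_fun M" "F = L2_rel M `` {f}"
    using assms by (auto simp: L2_def quotient_def)
  then have "f \<in> F"
    using equiv_class_self[OF equiv_L2_rel] by simp
  then have "L2_rep F \<in> F"
    unfolding L2_rep_def by (rule someI[where P = "\<lambda>f. f \<in> F"])
  then have "(f, L2_rep F) \<in> L2_rel M"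
    using f by simp
  then show "L2_rep F \<in> L2_fun M" "L2_class M (L2_rep F) = F"
    using equiv_class_eq[OF equiv_L2_rel] f(2) by (auto simp: L2_rel_def L2_class_def)
qed

lemma L2_class_eq_iff:
  "f \<in> L2_fun M \<Longrightarrow> g \<in> L2_fun M \<Longrightarrow> L2_class M f = L2_class M g \<longleftrightarrow> (AE x in M. f x = g x)"
  using eq_equiv_class_iff[OF equiv_L2_rel, of f M g] by (simp add: L2_class_def L2_rel_def)

lemma L2_rep_L2_class:
  assumes "f \<in> L2_fun M"
  shows "AE x in M. L2_rep (L2_class M f) x = f x"
  using L2_class_eq_iff[OF L2_rep_in_L2_fun[OF L2_class_in_carrier[OF assms]] assms]
    L2_class_L2_rep[OF L2_class_in_carrier[OF assms]] by simp

lemma L2_eqI: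
  assumes "F \<in> carrier (L2 M)" "G \<in> carrier (L2 M)" "AE x in M. L2_rep F x = L2_rep G x"
  shows "F = G"
  using assms L2_class_eq_iff[OF L2_rep_in_L2_fun L2_rep_in_L2_fun, of F M G] L2_class_L2_rep by metis

lemma L2_ops_in_carrier:
  assumes "F \<in> carrier (L2 M)"
  shows "G \<in> carrier (L2 M) \<Longrightarrow> F \<oplus>\<^bsub>L2 M\<^esub> G \<in> carrier (L2 M)"
    and "c \<odot>\<^bsub>L2 M\<^esub> F \<in> carrier (L2 M)"
    and "L2_abs M F \<in> carrier (L2 M)"
  using L2_rep_in_L2_fun[OF assms] L2_rep_in_L2_fun[of G M]
    L2_class_in_carrier[OF L2_fun_add, of "L2_rep F" M "L2_rep G"]
    L2_class_in_carrier[OF L2_fun_cmult, of "L2_rep F" M c]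
    L2_class_in_carrier[OF L2_fun_cmod, of "L2_rep F" M]
  by (simp_all add: L2_def L2_abs_def)

lemma L2_zero_in_carrier: "\<zero>\<^bsub>L2 M\<^esub> \<in> carrier (L2 M)"
  using L2_class_in_carrier[OF L2_fun_zero[of M]] by (simp add: L2_def)

lemma L2_rep_add:
  assumes "F \<in> carrier (L2 M)" "G \<in> carrier (L2 M)"
  shows "AE x in M. L2_rep (F \<oplus>\<^bsub>L2 M\<^esub> G) x = L2_rep F x + L2_rep G x"
  using L2_rep_L2_class[OF L2_fun_add[OF assms[THEN L2_rep_in_L2_fun]]] by (simp add: L2_def)

lemma L2_rep_smult:
  assumes "F \<in> carrier (L2 M)"
  shows "AE x in M. L2_rep (c \<odot>\<^bsub>L2 M\<^esub> F) x = c * L2_rep F x"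
  using L2_rep_L2_class[OF L2_fun_cmult[OF assms[THEN L2_rep_in_L2_fun]]] by (simp add: L2_def)

lemma L2_rep_zero: "AE x in M. L2_rep \<zero>\<^bsub>L2 M\<^esub> x = 0"
  using L2_rep_L2_class[OF L2_fun_zero[of M]] by (simp add: L2_def)

lemma L2_rep_abs:
  assumes "F \<in> carrier (L2 M)"
  shows "AE x in M. L2_rep (L2_abs M F) x = complex_of_real (cmod (L2_rep F x))"
  using L2_rep_L2_class[OF L2_fun_cmod[OF assms[THEN L2_rep_in_L2_fun]]] by (simp add: L2_abs_def)

lemma L2_cinner: "cinner (L2 M) F G = (\<integral>x. L2_rep F x * cnj (L2_rep G x) \<partial>M)"
  by (simp add: L2_def)

lemma L2_cinner_self:
  assumes "F \<in> carrier (L2 M)"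
  shows "cinner (L2 M) F F = complex_of_real (\<integral>x. (cmod (L2_rep F x))\<^sup>2 \<partial>M)"
  by (simp add: L2_cinner complex_norm_square[symmetric] flip: of_real_power)

text \<open>
  The operations on classes are computed on arbitrary representatives, so each axiom is checked
  almost everywhere and transferred by \<open>L2_eqI\<close>.
\<close>
lemma L2_module: "module complex_ring (L2 M)"
proof (rule moduleI)
  show "cring complex_ring"
    by (rule cring_from_type_algebra)
  note ops = L2_ops_in_carrier L2_zero_in_carrier
  show "abelian_group (L2 M)"
  proof (rule abelian_groupI)
    fix F G K
    assume F: "F \<in> carrier (L2 M)" 
    have "AE x in M. L2_rep ((-1) \<odot>\<^bsub>L2 M\<^esub> F \<oplus>\<^bsub>L2 M\<^esub> F) x = L2_rep \<zero>\<^bsub>L2 M\<^esub> x"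
      using L2_rep_add[OF ops(2)[OF F, of "-1"] F] L2_rep_smult[OF F, of "-1"] L2_rep_zero[of M]
      by eventually_elim simp
    then have "(-1) \<odot>\<^bsub>L2 M\<^esub> F \<oplus>\<^bsub>L2 M\<^esub> F = \<zero>\<^bsub>L2 M\<^esub>"
      by (intro L2_eqI[of _ M]) (simp_all add: ops F)
    then show "\<exists>K\<in>carrier (L2 M). K \<oplus>\<^bsub>L2 M\<^esub> F = \<zero>\<^bsub>L2 M\<^esub>"
      using ops(2)[OF F] by blast
    have "AE x in M. L2_rep (\<zero>\<^bsub>L2 M\<^esub> \<oplus>\<^bsub>L2 M\<^esub> F) x = L2_rep F x"
      using L2_rep_add[OF ops(4) F] L2_rep_zero[of M] by eventually_elim simp
    then show "\<zero>\<^bsub>L2 M\<^esub> \<oplus>\<^bsub>L2 M\<^esub> F = F"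
      by (intro L2_eqI[of _ M]) (simp_all add: ops F)
    assume G: "G \<in> carrier (L2 M)"
    show "F \<oplus>\<^bsub>L2 M\<^esub> G = G \<oplus>\<^bsub>L2 M\<^esub> F"
      by (simp add: L2_def add.commute)
    assume K: "K \<in> carrier (L2 M)"
    have "AE x in M. L2_rep (F \<oplus>\<^bsub>L2 M\<^esub> G \<oplus>\<^bsub>L2 M\<^esub> K) x = L2_rep (F \<oplus>\<^bsub>L2 M\<^esub> (G \<oplus>\<^bsub>L2 M\<^esub> K)) x"
      using L2_rep_add[OF F G] L2_rep_add[OF ops(1)[OF F G] K] L2_rep_add[OF G K]
        L2_rep_add[OF F ops(1)[OF G K]]
      by eventually_elim simp
    then show "F \<oplus>\<^bsub>L2 M\<^esub> G \<oplus>\<^bsub>L2 M\<^esub> K = F \<oplus>\<^bsub>L2 M\<^esub> (G \<oplus>\<^bsub>L2 M\<^esub> K)"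
      by (intro L2_eqI[of _ M]) (simp_all add: ops F G K)
  qed (simp_all add: ops)
  fix c d and F G
  assume F: "F \<in> carrier (L2 M)"
  have "AE x in M. L2_rep (1 \<odot>\<^bsub>L2 M\<^esub> F) x = L2_rep F x"
    using L2_rep_smult[OF F, of 1] by eventually_elim simp
  then show "\<one>\<^bsub>complex_ring\<^esub> \<odot>\<^bsub>L2 M\<^esub> F = F"
    by (intro L2_eqI[of _ M]) (simp_all add: ops F)
  show "c \<odot>\<^bsub>L2 M\<^esub> F \<in> carrier (L2 M)"
    by (simp add: ops F)
  have "AE x in M. L2_rep ((c + d) \<odot>\<^bsub>L2 M\<^esub> F) x = L2_rep (c \<odot>\<^bsub>L2 M\<^esub> F \<oplus>\<^bsub>L2 M\<^esub> d \<odot>\<^bsub>L2 M\<^esub> F) x"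
    using L2_rep_smult[OF F, of "c + d"] L2_rep_smult[OF F, of c] L2_rep_smult[OF F, of d]
      L2_rep_add[OF ops(2)[OF F, of c] ops(2)[OF F, of d]]
    by eventually_elim (simp add: algebra_simps)
  then show "(c \<oplus>\<^bsub>complex_ring\<^esub> d) \<odot>\<^bsub>L2 M\<^esub> F = c \<odot>\<^bsub>L2 M\<^esub> F \<oplus>\<^bsub>L2 M\<^esub> d \<odot>\<^bsub>L2 M\<^esub> F"
    by (intro L2_eqI[of _ M]) (simp_all add: ops F)
  have "AE x in M. L2_rep ((c * d) \<odot>\<^bsub>L2 M\<^esub> F) x = L2_rep (c \<odot>\<^bsub>L2 M\<^esub> (d \<odot>\<^bsub>L2 M\<^esub> F)) x"
    using L2_rep_smult[OF F, of "c * d"] L2_rep_smult[OF F, of d] L2_rep_smult[OF ops(2)[OF F], of c d]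
    by eventually_elim (simp add: algebra_simps)
  then show "(c \<otimes>\<^bsub>complex_ring\<^esub> d) \<odot>\<^bsub>L2 M\<^esub> F = c \<odot>\<^bsub>L2 M\<^esub> (d \<odot>\<^bsub>L2 M\<^esub> F)"
    by (intro L2_eqI[of _ M]) (simp_all add: ops F)
  assume G: "G \<in> carrier (L2 M)"
  have "AE x in M. L2_rep (c \<odot>\<^bsub>L2 M\<^esub> (F \<oplus>\<^bsub>L2 M\<^esub> G)) x = L2_rep (c \<odot>\<^bsub>L2 M\<^esub> F \<oplus>\<^bsub>L2 M\<^esub> c \<odot>\<^bsub>L2 M\<^esub> G) x"
    using L2_rep_smult[OF ops(1)[OF F G], of c] L2_rep_smult[OF F, of c] L2_rep_smult[OF G, of c]
      L2_rep_add[OF ops(2)[OF F, of c] ops(2)[OF G, of c]] L2_rep_add[OF F G]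
    by eventually_elim (simp add: algebra_simps)
  then show "c \<odot>\<^bsub>L2 M\<^esub> (F \<oplus>\<^bsub>L2 M\<^esub> G) = c \<odot>\<^bsub>L2 M\<^esub> F \<oplus>\<^bsub>L2 M\<^esub> c \<odot>\<^bsub>L2 M\<^esub> G"
    by (intro L2_eqI[of _ M]) (simp_all add: ops F G)
qed

lemma L2_inner_product_space: "complex_inner_product_space (L2 M)"
proof -
  interpret module complex_ring "L2 M"
    by (rule L2_module)
  show ?thesis
  proof
    fix F G K c
    assume F: "F \<in> carrier (L2 M)"
    note f = L2_rep_in_L2_fun[OF F]
    show "0 \<le> cinner (L2 M) F F"
      by (simp add: L2_cinner_self[OF F] less_eq_complex_def)
    show "F = \<zero>\<^bsub>L2 M\<^esub>" if "cinner (L2 M) F F = 0"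
    proof (rule L2_eqI[OF F M.zero_closed])
      have "AE x in M. (cmod (L2_rep F x))\<^sup>2 = 0"
        using that L2_fun_integrable_square[OF f] by (simp add: L2_cinner_self[OF F] integral_nonneg_eq_0_iff_AE)
      then show "AE x in M. L2_rep F x = L2_rep \<zero>\<^bsub>L2 M\<^esub> x"
        using L2_rep_zero[of M] by eventually_elim simp
    qed
    assume G: "G \<in> carrier (L2 M)"
    note g = L2_rep_in_L2_fun[OF G]
    show "cinner (L2 M) (c \<odot>\<^bsub>L2 M\<^esub> F) G = c * cinner (L2 M) F G"
    proof -
      have "cinner (L2 M) (c \<odot>\<^bsub>L2 M\<^esub> F) G = (\<integral>x. c * (L2_rep F x * cnj (L2_rep G x)) \<partial>M)"
        unfolding L2_cinner
      proof (rule integral_cong_AE)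
        show "AE x in M. L2_rep (c \<odot>\<^bsub>L2 M\<^esub> F) x * cnj (L2_rep G x) = c * (L2_rep F x * cnj (L2_rep G x))"
          using L2_rep_smult[OF F, of c] by eventually_elim simp
      qed (intro borel_measurable_integrable L2_fun_inner_integrable integrable_mult_right
          L2_rep_in_L2_fun L2_ops_in_carrier F G)+
      then show ?thesis
        by (simp add: L2_cinner)
    qed
    show "cinner (L2 M) G F = cnj (cinner (L2 M) F G)"
    proof -
      have "cnj (\<integral>x. L2_rep F x * cnj (L2_rep G x) \<partial>M) = (\<integral>x. cnj (L2_rep F x * cnj (L2_rep G x)) \<partial>M)"
        by (rule Bochner_Integration.integral_cnj[symmetric])
      also have "\<dots> = (\<integral>x. L2_rep G x * cnj (L2_rep F x) \<partial>M)"
        by (simp add: mult.commute)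
      finally show ?thesis
        by (simp add: L2_cinner)
    qed
    assume K: "K \<in> carrier (L2 M)"
    note k = L2_rep_in_L2_fun[OF K]
    show "cinner (L2 M) (F \<oplus>\<^bsub>L2 M\<^esub> G) K = cinner (L2 M) F K + cinner (L2 M) G K"
    proof -
      have "cinner (L2 M) (F \<oplus>\<^bsub>L2 M\<^esub> G) K
          = (\<integral>x. L2_rep F x * cnj (L2_rep K x) + L2_rep G x * cnj (L2_rep K x) \<partial>M)"
        unfolding L2_cinner
      proof (rule integral_cong_AE)
        show "AE x in M. L2_rep (F \<oplus>\<^bsub>L2 M\<^esub> G) x * cnj (L2_rep K x)
            = L2_rep F x * cnj (L2_rep K x) + L2_rep G x * cnj (L2_rep K x)"
          using L2_rep_add[OF F G] by eventually_elim (simp add: distrib_right)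
      qed (intro borel_measurable_integrable L2_fun_inner_integrable Bochner_Integration.integrable_add
          L2_rep_in_L2_fun L2_ops_in_carrier F G K)+
      then show ?thesis
        using Bochner_Integration.integral_add[OF L2_fun_inner_integrable[OF f k] L2_fun_inner_integrable[OF g k]]
        by (simp add: L2_cinner)
    qed
  qed
qed

lemma L2_rep_minus:
  assumes "F \<in> carrier (L2 M)" "G \<in> carrier (L2 M)"
  shows "AE x in M. L2_rep (F \<ominus>\<^bsub>L2 M\<^esub> G) x = L2_rep F x - L2_rep G x"
proof -
  interpret complex_inner_product_space "L2 M"
    by (rule L2_inner_product_space)
  show ?thesis
    using L2_rep_add[OF assms(1) L2_ops_in_carrier(2)[OF assms(2), of "-1"]]
      L2_rep_smult[OF assms(2), of "-1"] unfolding minus_eq_smult[OF assms]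
    by eventually_elim simp
qed

lemma L2_hnorm_square:
  assumes "F \<in> carrier (L2 M)"
  shows "(hnorm (L2 M) F)\<^sup>2 = (\<integral>x. (cmod (L2_rep F x))\<^sup>2 \<partial>M)"
  using complex_inner_product_space.hnorm_square[OF L2_inner_product_space assms]
  by (simp add: L2_cinner_self[OF assms])

lemma L2_hnorm_mono:
  assumes "F \<in> carrier (L2 M)" "G \<in> carrier (L2 M)"
    and "AE x in M. cmod (L2_rep F x) \<le> cmod (L2_rep G x)"
  shows "(hnorm (L2 M) F)\<^sup>2 \<le> (hnorm (L2 M) G)\<^sup>2"
  unfolding L2_hnorm_square[OF assms(1)] L2_hnorm_square[OF assms(2)]
proof (rule integral_mono_AE)
  show "AE x in M. (cmod (L2_rep F x))\<^sup>2 \<le> (cmod (L2_rep G x))\<^sup>2"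
    using assms(3) by eventually_elim (simp add: power_mono)
qed (use L2_rep_in_L2_fun assms L2_fun_integrable_square in blast)+

lemma L2_hnorm_abs:
  assumes "F \<in> carrier (L2 M)"
  shows "(hnorm (L2 M) (L2_abs M F))\<^sup>2 = (hnorm (L2 M) F)\<^sup>2"
proof (rule antisym; rule L2_hnorm_mono)
  have "AE x in M. cmod (L2_rep (L2_abs M F) x) = cmod (L2_rep F x)"
    using L2_rep_abs[OF assms] by eventually_elim simp
  then show "AE x in M. cmod (L2_rep (L2_abs M F) x) \<le> cmod (L2_rep F x)"
    "AE x in M. cmod (L2_rep F x) \<le> cmod (L2_rep (L2_abs M F) x)"
    by (auto elim: eventually_mono)
qed (use assms L2_ops_in_carrier(3) in auto)

section \<open>Moduli and truncation of square integrable functions\<close>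

lemma L2_pos_in_carrier: "F \<in> L2_pos M \<Longrightarrow> F \<in> carrier (L2 M)"
  by (simp add: L2_pos_def)

lemma L2_pos_rep: "F \<in> L2_pos M \<Longrightarrow> AE x in M. L2_rep F x = complex_of_real (cmod (L2_rep F x))"
  unfolding L2_pos_def mem_Collect_eq
  by (elim conjE eventually_mono) (simp add: less_eq_complex_def complex_eq_iff cmod_eq_Re)

lemma L2_abs_in_L2_pos:
  assumes "F \<in> carrier (L2 M)"
  shows "L2_abs M F \<in> L2_pos M"
proof -
  have "AE x in M. 0 \<le> L2_rep (L2_abs M F) x"
    using L2_rep_abs[OF assms] by eventually_elim (simp add: less_eq_complex_def)
  then show ?thesis
    using L2_ops_in_carrier(3)[OF assms] by (simp add: L2_pos_def)
qed

lemma L2_abs_of_pos: "F \<in> L2_pos M \<Longrightarrow> L2_abs M F = F"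
proof (rule L2_eqI[of _ M])
  assume F: "F \<in> L2_pos M"
  then show c: "L2_abs M F \<in> carrier (L2 M)" "F \<in> carrier (L2 M)"
    using L2_pos_in_carrier L2_ops_in_carrier(3) by blast+
  show "AE x in M. L2_rep (L2_abs M F) x = L2_rep F x"
    using L2_pos_rep[OF F] L2_rep_abs[OF c(2)] by eventually_elim simp
qed

text \<open>
  The formula \<open>(F + G - |F - G|)/2\<close> for the pointwise minimum of nonnegative \<open>F\<close> and \<open>G\<close>; in this
  form the first Beurling-Deny criterion applies to the minimum at once.
\<close>
definition L2_meet :: "'x measure \<Rightarrow> ('x \<Rightarrow> complex) set \<Rightarrow> ('x \<Rightarrow> complex) set \<Rightarrow> ('x \<Rightarrow> complex) set" where
  "L2_meet M F G =
     (1/2) \<odot>\<^bsub>L2 M\<^esub> ((F \<oplus>\<^bsub>L2 M\<^esub> G) \<ominus>\<^bsub>L2 M\<^esub> L2_abs M (F \<ominus>\<^bsub>L2 M\<^esub> G))"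

lemma L2_rep_meet:
  assumes "F \<in> L2_pos M" "G \<in> L2_pos M"
  shows "AE x in M. L2_rep (L2_meet M F G) x
    = complex_of_real (min (cmod (L2_rep F x)) (cmod (L2_rep G x)))"
proof -
  interpret complex_inner_product_space "L2 M"
    by (rule L2_inner_product_space)
  have c: "F \<in> carrier (L2 M)" "G \<in> carrier (L2 M)"
    using assms L2_pos_in_carrier by blast+
  then have d: "F \<ominus>\<^bsub>L2 M\<^esub> G \<in> carrier (L2 M)" "F \<oplus>\<^bsub>L2 M\<^esub> G \<in> carrier (L2 M)"
    by simp_all
  note a = L2_ops_in_carrier(3)[OF d(1)]
  have min: "(p + q - \<bar>p - q\<bar>) / 2 = min p q" for p q :: real
    by (auto simp: min_def)
  show ?thesis
    using L2_rep_smult[OF M.minus_closed[OF d(2) a], of "1/2"] L2_rep_minus[OF d(2) a]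
      L2_rep_abs[OF d(1)] L2_rep_minus[OF c] L2_rep_add[OF c]
      L2_pos_rep[OF assms(1)] L2_pos_rep[OF assms(2)]
    unfolding L2_meet_def
  proof eventually_elim
    case (elim x)
    define p q where "p = cmod (L2_rep F x)" "q = cmod (L2_rep G x)"
    have "L2_rep F x = complex_of_real p" "L2_rep G x = complex_of_real q"
      using elim(6,7) by (simp_all add: p_q_def)
    then show ?case
      using elim(1-5) unfolding p_q_def[symmetric] min[symmetric]
      by (simp flip: of_real_diff of_real_add)
  qed
qed

lemma L2_meet_in_carrier:
  assumes "F \<in> carrier (L2 M)" "G \<in> carrier (L2 M)"
  shows "L2_meet M F G \<in> carrier (L2 M)"
proof -
  interpret complex_inner_product_space "L2 M"
    by (rule L2_inner_product_space)
  show ?thesis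
    unfolding L2_meet_def by (intro smult_in_carrier M.minus_closed M.add.m_closed L2_ops_in_carrier(3) assms)
qed

lemma L2_meet_pos:
  assumes "F \<in> L2_pos M" "G \<in> L2_pos M"
  shows "L2_meet M F G \<in> L2_pos M"
proof -
  have "AE x in M. 0 \<le> L2_rep (L2_meet M F G) x"
    using L2_rep_meet[OF assms] by eventually_elim (simp add: less_eq_complex_def)
  then show ?thesis
    using L2_meet_in_carrier[OF assms[THEN L2_pos_in_carrier]] by (simp add: L2_pos_def)
qed

lemma L2_meet_le:
  assumes "F \<in> L2_pos M" "G \<in> L2_pos M"
  shows "L2_le M (L2_meet M F G) F" "L2_le M (L2_meet M F G) G"
proof -
  have le: "complex_of_real s \<le> z" if "z = complex_of_real t" "s \<le> t" for s t z
    using that by (simp add: less_eq_complex_def)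
  show "L2_le M (L2_meet M F G) F"
    unfolding L2_le_def using L2_rep_meet[OF assms] L2_pos_rep[OF assms(1)]
  proof eventually_elim
    case (elim x)
    then show ?case
      unfolding elim(1) by (intro le[OF elim(2)]) simp
  qed
  show "L2_le M (L2_meet M F G) G"
    unfolding L2_le_def using L2_rep_meet[OF assms] L2_pos_rep[OF assms(2)]
  proof eventually_elim
    case (elim x)
    then show ?case
      unfolding elim(1) by (intro le[OF elim(2)]) simp
  qed
qed

text \<open>
  Truncating at \<open>|G|\<close> does not move a nonnegative \<open>F\<close> farther than \<open>G\<close> is away from it, by the
  pointwise estimate \<open>F - min F |G| \<le> |F - |G|| \<le> |F - G|\<close>.
\<close>
lemma L2_meet_abs_dist:
  assumes "F \<in> L2_pos M" "G \<in> carrier (L2 M)"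
  shows "(hnorm (L2 M) (F \<ominus>\<^bsub>L2 M\<^esub> L2_meet M F (L2_abs M G)))\<^sup>2 \<le> (hnorm (L2 M) (F \<ominus>\<^bsub>L2 M\<^esub> G))\<^sup>2"
proof -
  interpret complex_inner_product_space "L2 M"
    by (rule L2_inner_product_space)
  note F = L2_pos_in_carrier[OF assms(1)] and A = L2_abs_in_L2_pos[OF assms(2)]
  note m = L2_meet_in_carrier[OF F L2_pos_in_carrier[OF A]]
  have bound: "\<bar>p - min p q\<bar> \<le> \<bar>p - q\<bar>" for p q :: real
    by (auto simp: min_def)
  show ?thesis
  proof (rule L2_hnorm_mono)
    show "AE x in M. cmod (L2_rep (F \<ominus>\<^bsub>L2 M\<^esub> L2_meet M F (L2_abs M G)) x) \<le> cmod (L2_rep (F \<ominus>\<^bsub>L2 M\<^esub> G) x)"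
      using L2_rep_minus[OF F m] L2_rep_minus[OF F assms(2)] L2_rep_meet[OF assms(1) A]
        L2_rep_abs[OF assms(2)] L2_pos_rep[OF assms(1)]
    proof eventually_elim
      case (elim x)
      let ?p = "cmod (L2_rep F x)" and ?q = "cmod (L2_rep G x)"
      have "L2_rep (F \<ominus>\<^bsub>L2 M\<^esub> L2_meet M F (L2_abs M G)) x = complex_of_real (?p - min ?p ?q)"
        using elim(1,3,4,5) by simp
      then have "cmod (L2_rep (F \<ominus>\<^bsub>L2 M\<^esub> L2_meet M F (L2_abs M G)) x) = \<bar>?p - min ?p ?q\<bar>"
        by (simp only: norm_of_real)
      also have "\<dots> \<le> \<bar>?p - ?q\<bar>"
        by (rule bound)
      also have "\<dots> \<le> cmod (L2_rep F x - L2_rep G x)"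
        by (rule norm_triangle_ineq3)
      finally show ?case
        using elim(2) by simp
    qed
  qed (use F m assms(2) in simp_all)
qed

section \<open>The first Beurling-Deny criterion and truncation\<close>

lemma shifted_form_abs_le:
  assumes "first_Beurling_Deny M b" "f \<in> qdom b" "f \<in> carrier (L2 M)"
  shows "shifted_form (L2 M) b \<mu> (L2_abs M f) \<le> shifted_form (L2 M) b \<mu> f"
  using assms L2_hnorm_abs[OF assms(3)] by (auto simp: shifted_form_def first_Beurling_Deny_def)

text \<open>
  With \<open>s = f + g\<close> and \<open>d = f - g\<close> the minimum is \<open>(s - |d|)/2\<close>, so its value is at most
  \<open>(Q(s) + Q(|d|))/2 \<le> (Q(s) + Q(d))/2 = Q(f) + Q(g)\<close> by the first Beurling-Deny criterion and the
  parallelogram law.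
\<close>
lemma shifted_form_meet_le:
  assumes b: "quadratic_form (L2 M) b" "form_shift (L2 M) b \<mu>" "first_Beurling_Deny M b"
    and f: "f \<in> qdom b" and g: "g \<in> qdom b"
  shows "L2_meet M f g \<in> qdom b"
    and "shifted_form (L2 M) b \<mu> (L2_meet M f g)
      \<le> shifted_form (L2 M) b \<mu> f + shifted_form (L2 M) b \<mu> g"
proof -
  interpret complex_inner_product_space "L2 M"
    by (rule L2_inner_product_space)
  define Q where "Q = shifted_form (L2 M) b \<mu>"
  have D: "subspace_of (L2 M) (qdom b)"
    using b(1) unfolding quadratic_form_def by auto
  note cl = subspace_closed[OF D]
  have P: "parallelogram_law (L2 M) (qdom b) Q"
    unfolding Q_def by (rule shifted_form_parallelogram[OF b(1)])
  have Q0: "\<And>h. h \<in> qdom b \<Longrightarrow> 0 \<le> Q h"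
    unfolding Q_def by (rule form_shift_nonneg[OF b(2)])
  define s d where "s = f \<oplus>\<^bsub>L2 M\<^esub> g" and "d = f \<ominus>\<^bsub>L2 M\<^esub> g"
  have s: "s \<in> qdom b" and d: "d \<in> qdom b"
    using cl f g by (simp_all add: s_def d_def)
  have ad: "L2_abs M d \<in> qdom b"
    using b(3) d unfolding first_Beurling_Deny_def by blast
  have m: "L2_meet M f g = (1/2) \<odot>\<^bsub>L2 M\<^esub> (s \<ominus>\<^bsub>L2 M\<^esub> L2_abs M d)"
    by (simp add: L2_meet_def s_def d_def)
  show "L2_meet M f g \<in> qdom b"
    unfolding m by (intro cl s ad)
  have "Q (L2_meet M f g) = Q (s \<ominus>\<^bsub>L2 M\<^esub> L2_abs M d) / 4"
    unfolding m by (rule parallelogram_half[OF D P cl(5)[OF s ad]])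
  also have "\<dots> \<le> (2 * Q s + 2 * Q (L2_abs M d)) / 4"
    using parallelogram_le(2)[OF D P Q0 s ad] by simp
  also have "\<dots> \<le> (2 * Q s + 2 * Q d) / 4"
    using shifted_form_abs_le[OF b(3) d cl(1)[OF d], of \<mu>] by (simp add: Q_def)
  also have "\<dots> = Q f + Q g"
  proof -
    have "Q s + Q d = 2 * Q f + 2 * Q g"
      using P f g unfolding parallelogram_law_def s_def d_def by blast
    then show ?thesis by simp
  qed
  finally show "shifted_form (L2 M) b \<mu> (L2_meet M f g)
      \<le> shifted_form (L2 M) b \<mu> f + shifted_form (L2 M) b \<mu> g"
    by (simp add: Q_def)
qed

section \<open>Absolute maps and paired elements\<close>

lemma absolute_map_cinner_self:
  assumes "complex_inner_product_space H" "absolute_map H M A" "\<xi> \<in> carrier H"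
  shows "cinner H \<xi> \<xi> = cinner (L2 M) (A \<xi>) (A \<xi>)"
proof -
  have "complex_of_real (cmod (cinner H \<xi> \<xi>)) = cinner (L2 M) (A \<xi>) (A \<xi>)"
    using assms(2,3) unfolding absolute_map_def by blast
  moreover have "complex_of_real (cmod (cinner H \<xi> \<xi>)) = cinner H \<xi> \<xi>"
    using complex_inner_product_space.inner_nonneg[OF assms(1,3)]
    by (simp add: less_eq_complex_def complex_eq_iff cmod_eq_Re)
  ultimately show ?thesis by simp
qed

lemma absolute_map_hnorm:
  assumes "complex_inner_product_space H" "absolute_map H M A" "\<xi> \<in> carrier H"
  shows "hnorm (L2 M) (A \<xi>) = hnorm H \<xi>"
  by (simp add: hnorm_def absolute_map_cinner_self[OF assms])

text \<open>
  An absolute map preserves norms, and pairedness means that the inner product is preserved too.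
\<close>
lemma paired_dist:
  assumes "complex_inner_product_space H" "absolute_map H M A" "\<xi> \<in> carrier H" "\<eta> \<in> carrier H"
    and "paired H M A \<xi> \<eta>"
  shows "(hnorm H (\<xi> \<ominus>\<^bsub>H\<^esub> \<eta>))\<^sup>2 = (hnorm (L2 M) (A \<xi> \<ominus>\<^bsub>L2 M\<^esub> A \<eta>))\<^sup>2"
proof -
  interpret complex_inner_product_space H by fact
  interpret L: complex_inner_product_space "L2 M" by (rule L2_inner_product_space)
  have "A \<xi> \<in> carrier (L2 M)" "A \<eta> \<in> carrier (L2 M)"
    using assms(2-4) by (auto simp: absolute_map_def L2_pos_def)
  then show ?thesis
    using assms(3-5) absolute_map_hnorm[OF assms(1,2)]
    by (simp add: hnorm_minus_square L.hnorm_minus_square paired_def)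
qed

text \<open>
  Put \<open>w = |\<xi> - \<eta>|\<close> and \<open>v = |\<xi>| - |\<eta>|\<close>.  Both have the norm of \<open>\<xi> - \<eta>\<close>, so \<open>w = v\<close> follows from
  \<open>\<parallel>v\<parallel>\<^sup>2 \<le> \<langle>w,v\<rangle>\<close>.  To see this, test against \<open>\<zeta>\<close> with \<open>|\<zeta>| = v\<close> that is paired with \<open>\<xi>\<close>, which exists
  because \<open>v \<ge> 0\<close>: \<open>\<langle>v,|\<xi>| - |\<eta>|\<rangle> \<le> Re \<langle>\<zeta>,\<xi> - \<eta>\<rangle> \<le> \<langle>v,w\<rangle>\<close>.
\<close>
lemma paired_minus:
  assumes H: "complex_inner_product_space H" and A: "absolute_pairing H M A"
    and \<xi>: "\<xi> \<in> carrier H" and \<eta>: "\<eta> \<in> carrier H" and p: "paired H M A \<xi> \<eta>"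
    and le: "L2_le M (A \<eta>) (A \<xi>)"
  shows "A (\<xi> \<ominus>\<^bsub>H\<^esub> \<eta>) = A \<xi> \<ominus>\<^bsub>L2 M\<^esub> A \<eta>" and "paired H M A \<eta> (\<xi> \<ominus>\<^bsub>H\<^esub> \<eta>)"
proof -
  interpret complex_inner_product_space H by fact
  interpret L: complex_inner_product_space "L2 M" by (rule L2_inner_product_space)
  have map: "absolute_map H M A"
    using A unfolding absolute_pairing_def by blast
  have ac: "A \<zeta> \<in> carrier (L2 M)" if "\<zeta> \<in> carrier H" for \<zeta>
    using map that by (auto simp: absolute_map_def L2_pos_def)
  have bound: "Re (cinner H \<zeta> \<theta>) \<le> Re (cinner (L2 M) (A \<zeta>) (A \<theta>))"
    if "\<zeta> \<in> carrier H" "\<theta> \<in> carrier H" for \<zeta> \<theta>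
  proof -
    have "complex_of_real (cmod (cinner H \<zeta> \<theta>)) \<le> cinner (L2 M) (A \<zeta>) (A \<theta>)"
      using map that unfolding absolute_map_def by blast
    then show ?thesis
      using complex_Re_le_cmod[of "cinner H \<zeta> \<theta>"] by (simp add: less_eq_complex_def)
  qed
  define w where "w = A (\<xi> \<ominus>\<^bsub>H\<^esub> \<eta>)"
  define v where "v = A \<xi> \<ominus>\<^bsub>L2 M\<^esub> A \<eta>"
  have d: "\<xi> \<ominus>\<^bsub>H\<^esub> \<eta> \<in> carrier H" and w: "w \<in> carrier (L2 M)" and v: "v \<in> carrier (L2 M)"
    using \<xi> \<eta> ac by (simp_all add: w_def v_def)
  have "AE x in M. 0 \<le> L2_rep v x"
    using L2_rep_minus[OF ac[OF \<xi>] ac[OF \<eta>]] le unfolding L2_le_def v_def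
    by eventually_elim (simp add: less_eq_complex_def)
  then have "v \<in> L2_pos M"
    using v by (simp add: L2_pos_def)
  then obtain \<zeta> where \<zeta>: "\<zeta> \<in> carrier H" "A \<zeta> = v" "paired H M A \<xi> \<zeta>"
    using A \<xi> unfolding absolute_pairing_def by blast
  have nv: "(hnorm (L2 M) v)\<^sup>2 = (hnorm H (\<xi> \<ominus>\<^bsub>H\<^esub> \<eta>))\<^sup>2"
    using paired_dist[OF H map \<xi> \<eta> p] by (simp add: v_def)
  have nw: "(hnorm (L2 M) w)\<^sup>2 = (hnorm H (\<xi> \<ominus>\<^bsub>H\<^esub> \<eta>))\<^sup>2"
    using absolute_map_hnorm[OF H map d] by (simp add: w_def)
  have self: "cinner H \<eta> \<eta> = cinner (L2 M) (A \<eta>) (A \<eta>)"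
    using absolute_map_cinner_self[OF H map \<eta>] .
  have "(hnorm (L2 M) v)\<^sup>2 = Re (cinner (L2 M) v (A \<xi>)) - Re (cinner (L2 M) v (A \<eta>))"
    using L.cinner_minus_right[OF ac[OF \<xi>] ac[OF \<eta>] v] L.hnorm_square[OF v] by (simp add: v_def)
  also have "\<dots> \<le> Re (cinner H \<zeta> \<xi>) - Re (cinner H \<zeta> \<eta>)"
    using bound[OF \<zeta>(1) \<eta>] \<zeta>(2,3) inner_commute[OF \<xi> \<zeta>(1)] L.inner_commute[OF ac[OF \<xi>] v]
    by (simp add: paired_def)
  also have "\<dots> = Re (cinner H \<zeta> (\<xi> \<ominus>\<^bsub>H\<^esub> \<eta>))"
    using cinner_minus_right[OF \<xi> \<eta> \<zeta>(1)] by simp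
  also have "\<dots> \<le> Re (cinner (L2 M) w v)"
    using bound[OF \<zeta>(1) d] \<zeta>(2) L.inner_commute[OF v w] by (simp add: w_def)
  finally have "(hnorm (L2 M) v)\<^sup>2 \<le> Re (cinner (L2 M) w v)" .
  then have "(hnorm (L2 M) (w \<ominus>\<^bsub>L2 M\<^esub> v))\<^sup>2 \<le> 0"
    using L.hnorm_minus_square[OF w v] nv nw by simp
  then have wv: "w = v"
    using L.eq_if_hnorm_minus_zero[OF w v] by (simp add: order_antisym)
  then show "A (\<xi> \<ominus>\<^bsub>H\<^esub> \<eta>) = A \<xi> \<ominus>\<^bsub>L2 M\<^esub> A \<eta>"
    by (simp add: w_def v_def)
  have "cinner H \<eta> (\<xi> \<ominus>\<^bsub>H\<^esub> \<eta>) = cnj (cinner H \<xi> \<eta>) - cinner H \<eta> \<eta>"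
    using cinner_minus_right[OF \<xi> \<eta> \<eta>] inner_commute[OF \<xi> \<eta>] by simp
  also have "\<dots> = cnj (cinner (L2 M) (A \<xi>) (A \<eta>)) - cinner (L2 M) (A \<eta>) (A \<eta>)"
    using p self by (simp add: paired_def)
  also have "\<dots> = cinner (L2 M) (A \<eta>) v"
    using L.cinner_minus_right[OF ac[OF \<xi>] ac[OF \<eta>] ac[OF \<eta>]] L.inner_commute[OF ac[OF \<xi>] ac[OF \<eta>]]
    by (simp add: v_def)
  finally show "paired H M A \<eta> (\<xi> \<ominus>\<^bsub>H\<^esub> \<eta>)"
    using wv by (simp add: paired_def w_def)
qed

section \<open>Domination and cores\<close>

text \<open>
  By \<open>paired_minus\<close> domination may be applied to the pair \<open>\<eta>, \<xi> - \<eta>\<close>.  Polarization turns both mixed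
  terms into form values, for instance \<open>2 Re a(\<eta>, \<xi> - \<eta>) = a(\<xi>) - a(\<eta>) - a(\<xi> - \<eta>)\<close>.  The shift \<open>\<mu>\<close>
  may be added on both sides because \<open>\<xi>\<close>, \<open>\<eta>\<close> and \<open>\<xi> - \<eta>\<close> have the norms of their moduli; it makes the
  term with \<open>\<xi> - \<eta>\<close> nonnegative, and that term is dropped.
\<close>
lemma dominated_form_estimate:
  assumes H: "complex_inner_product_space H" and A: "absolute_pairing H M A"
    and a: "quadratic_form H a" "form_shift H a \<mu>" and b: "quadratic_form (L2 M) b"
    and dom: "dominated_by H M A a b"
    and \<xi>: "\<xi> \<in> qdom a" and \<eta>: "\<eta> \<in> qdom a" and p: "paired H M A \<xi> \<eta>"
    and le: "L2_le M (A \<eta>) (A \<xi>)"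
  shows "shifted_form H a \<mu> \<eta> \<le> shifted_form H a \<mu> \<xi> + shifted_form (L2 M) b \<mu> (A \<eta>)
     + shifted_form (L2 M) b \<mu> (A \<xi> \<ominus>\<^bsub>L2 M\<^esub> A \<eta>) - shifted_form (L2 M) b \<mu> (A \<xi>)"
proof -
  interpret complex_inner_product_space H by fact
  interpret L: complex_inner_product_space "L2 M" by (rule L2_inner_product_space)
  have D: "subspace_of H (qdom a)"
    using a(1) unfolding quadratic_form_def by blast
  have Db: "subspace_of (L2 M) (qdom b)"
    using b unfolding quadratic_form_def by blast
  have map: "absolute_map H M A"
    using A unfolding absolute_pairing_def by blast
  note cl = subspace_closed[OF D]
  have c: "\<xi> \<in> carrier H" "\<eta> \<in> carrier H"
    using cl(1) \<xi> \<eta> by blast+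
  have d: "\<xi> \<ominus>\<^bsub>H\<^esub> \<eta> \<in> qdom a"
    by (rule cl(5)[OF \<xi> \<eta>])
  have Aq: "A \<zeta> \<in> qdom b" if "\<zeta> \<in> qdom a" for \<zeta>
    using dom that unfolding dominated_by_def generalized_ideal_of_def by blast
  note pm = paired_minus[OF H A c p le]
  note norms = absolute_map_hnorm[OF H map c(1)] absolute_map_hnorm[OF H map c(2)]
    absolute_map_hnorm[OF H map cl(1)[OF d], unfolded pm(1)]
  have "Re (polar (L2 M) b (A \<eta>) (A (\<xi> \<ominus>\<^bsub>H\<^esub> \<eta>))) \<le> Re (polar H a \<eta> (\<xi> \<ominus>\<^bsub>H\<^esub> \<eta>))"
    using dom \<eta> d pm(2) unfolding dominated_by_def by blast
  moreover have "2 * Re (polar H a \<eta> (\<xi> \<ominus>\<^bsub>H\<^esub> \<eta>)) = qval a \<xi> - qval a \<eta> - qval a (\<xi> \<ominus>\<^bsub>H\<^esub> \<eta>)"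
    using Re_polar[OF a(1) \<eta> d] add_minus_cancel[OF c(2,1)] by simp
  moreover have "2 * Re (polar (L2 M) b (A \<eta>) (A (\<xi> \<ominus>\<^bsub>H\<^esub> \<eta>)))
      = qval b (A \<xi>) - qval b (A \<eta>) - qval b (A \<xi> \<ominus>\<^bsub>L2 M\<^esub> A \<eta>)"
    using L.Re_polar[OF b Aq[OF \<eta>] Aq[OF d]] L.subspace_closed(1)[OF Db] Aq \<xi> \<eta>
    by (simp add: pm(1) L.add_minus_cancel)
  ultimately have "qval a \<eta> + qval a (\<xi> \<ominus>\<^bsub>H\<^esub> \<eta>)
      \<le> qval a \<xi> + qval b (A \<eta>) + qval b (A \<xi> \<ominus>\<^bsub>L2 M\<^esub> A \<eta>) - qval b (A \<xi>)"
    by linarith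
  then show ?thesis
    using form_shift_nonneg[OF a(2) d] by (simp add: shifted_form_def norms)
qed

theorem theorem2p3:
  fixes H :: "('a, 'c) hilbert_scheme" and M :: "'x measure"
    and A :: "'a \<Rightarrow> ('x \<Rightarrow> complex) set"
    and a :: "'a qform" and b :: "('x \<Rightarrow> complex) set qform"
    and Da :: "'a set" and Db :: "('x \<Rightarrow> complex) set set"
    and \<mu>\<^sub>a \<mu>\<^sub>b :: real
  assumes "complex_hilbert_space H"
    and "absolute_pairing H M A"
    and "closed_form H a \<mu>\<^sub>a"
    and "closed_form (L2 M) b \<mu>\<^sub>b"
    and "first_Beurling_Deny M b"
    and "ideal_of H M A Da (qdom a)"
    and "ideal_of (L2 M) M (L2_abs M) Db (qdom b)"
    and "dominated_by H M A a b"
    and "Db \<inter> L2_pos M \<inter> A ` qdom a \<subseteq> A ` Da"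
    and "is_core (L2 M) b \<mu>\<^sub>b Db"
  shows "is_core H a \<mu>\<^sub>a Da"
proof -
  have H: "complex_inner_product_space H"
    using assms(1) by (rule complex_hilbert_space.complex_inner_product_space)
  interpret complex_inner_product_space H by (rule H)
  interpret L: complex_inner_product_space "L2 M" by (rule L2_inner_product_space)
  have a: "quadratic_form H a" "form_shift H a \<mu>\<^sub>a"
    and b: "quadratic_form (L2 M) b" "form_shift (L2 M) b \<mu>\<^sub>b"
    using assms(3,4) unfolding closed_form_def by auto
  have Da: "subspace_of H Da" "Da \<subseteq> qdom a"
    and Da_ideal: "\<And>f g. f \<in> Da \<Longrightarrow> g \<in> qdom a \<Longrightarrow> L2_le M (A g) (A f) \<Longrightarrow> g \<in> Da"
    using assms(6) unfolding ideal_of_def by blast+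
  have Db: "Db \<subseteq> qdom b" "subspace_of (L2 M) (qdom b)"
    and Db_ideal: "\<And>f g. f \<in> Db \<Longrightarrow> g \<in> qdom b \<Longrightarrow> L2_le M (L2_abs M g) (L2_abs M f) \<Longrightarrow> g \<in> Db"
    using assms(7) unfolding ideal_of_def by blast+
  have Db_dense: "\<And>f e. f \<in> qdom b \<Longrightarrow> e > 0 \<Longrightarrow> \<exists>g\<in>Db. form_norm (L2 M) b \<mu>\<^sub>b (f \<ominus>\<^bsub>L2 M\<^esub> g) < e"
    using assms(10) unfolding is_core_def dense_wrt_def by blast
  have dom: "subspace_of H (qdom a)" "\<And>\<xi>. \<xi> \<in> qdom a \<Longrightarrow> A \<xi> \<in> qdom b"
    and lift: "\<And>\<xi> f. \<xi> \<in> qdom a \<Longrightarrow> f \<in> qdom b \<Longrightarrow> f \<in> L2_pos M \<Longrightarrow> L2_le M f (A \<xi>)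
      \<Longrightarrow> \<exists>\<eta>\<in>qdom a. A \<eta> = f \<and> paired H M A \<xi> \<eta>"
    using assms(8) unfolding dominated_by_def generalized_ideal_of_def by blast+
  have map: "absolute_map H M A"
    using assms(2) unfolding absolute_pairing_def by blast
  note cla = subspace_closed[OF dom(1)] and clb = L.subspace_closed[OF Db(2)]
  define Q where "Q = shifted_form (L2 M) b \<mu>\<^sub>b"
  define n where "n f = (hnorm (L2 M) f)\<^sup>2" for f
  have Qpar: "parallelogram_law (L2 M) (qdom b) Q"
    unfolding Q_def by (rule L.shifted_form_parallelogram[OF b(1)])
  have Q0: "\<And>f. f \<in> qdom b \<Longrightarrow> 0 \<le> Q f"
    unfolding Q_def by (rule form_shift_nonneg[OF b(2)])
  have npar: "parallelogram_law (L2 M) (carrier (L2 M)) n"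
    using L.hnorm_parallelogram unfolding n_def .
  have n0: "\<And>f. 0 \<le> n f"
    by (simp add: n_def)
  obtain c where c: "c > 0" "\<And>f. f \<in> qdom b \<Longrightarrow> c * n f \<le> Q f"
    using form_shift_bound[OF b(2)] unfolding Q_def n_def by blast
  \<comment> \<open>The estimate below needs the same shift for both forms; passing from \<open>\<mu>\<^sub>b\<close> to \<open>\<mu>\<^sub>a\<close> costs a bounded term.\<close>
  have change: "\<bar>shifted_form (L2 M) b \<mu>\<^sub>a f - Q f\<bar> = \<bar>\<mu>\<^sub>a - \<mu>\<^sub>b\<bar> * n f" for f
  proof -
    have "shifted_form (L2 M) b \<mu>\<^sub>a f - Q f = (\<mu>\<^sub>a - \<mu>\<^sub>b) * n f"
      by (simp add: shifted_form_def Q_def n_def algebra_simps)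
    then show ?thesis
      using n0[of f] by (simp add: abs_mult)
  qed
  show ?thesis
    unfolding is_core_def dense_wrt_def
  proof (intro conjI ballI allI impI Da)
    fix \<xi> and e :: real
    assume \<xi>: "\<xi> \<in> qdom a" and e: "e > 0"
    define u where "u = A \<xi>"
    have u: "u \<in> qdom b" "u \<in> L2_pos M" "u \<in> carrier (L2 M)"
      using dom(2)[OF \<xi>] map cla(1)[OF \<xi>] unfolding absolute_map_def u_def L2_pos_def by auto
    \<comment> \<open>Fixed before \<open>g\<close> and \<open>f\<close> are chosen.  After the term of \<open>\<xi>\<close>, the summands bound \<open>Q f\<close>, \<open>Q (u - f)\<close> and the cost of the common shift.\<close>
    define C where "C = shifted_form H a \<mu>\<^sub>a \<xi> + (3 * Q u + 2) + (8 * Q u + 4)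
      + \<bar>\<mu>\<^sub>a - \<mu>\<^sub>b\<bar> * (3 * n u + 3)"
    have "\<exists>\<eta>\<in>Da. (hnorm H (\<eta> \<ominus>\<^bsub>H\<^esub> \<xi>))\<^sup>2 < r \<and> shifted_form H a \<mu>\<^sub>a \<eta> \<le> C" if r: "r > 0" for r
    proof -
      \<comment> \<open>Chosen so that \<open>Q (u - g) < t\<close> forces \<open>Q (u - g) < 1\<close> and, by the choice of \<open>c\<close>, \<open>n (u - g) < min 1 r\<close>.\<close>
      define t where "t = min 1 (c * min 1 r)"
      have t: "t > 0" "t \<le> 1" "t \<le> c * min 1 r"
        using c(1) r by (auto simp: t_def)
      obtain g where g: "g \<in> Db" "form_norm (L2 M) b \<mu>\<^sub>b (u \<ominus>\<^bsub>L2 M\<^esub> g) < sqrt t"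
        using Db_dense[OF u(1), of "sqrt t"] t(1) by auto
      have gD: "g \<in> qdom b" "g \<in> carrier (L2 M)"
        using g(1) Db(1) clb(1) by blast+
      note ug = clb(5)[OF u(1) gD(1)]
      have Qug: "Q (u \<ominus>\<^bsub>L2 M\<^esub> g) < t"
        using g(2) by (simp add: form_norm_eq Q_def)
      have "c * n (u \<ominus>\<^bsub>L2 M\<^esub> g) < c * min 1 r"
        using c(2)[OF ug] Qug t(3) by linarith
      then have nug: "n (u \<ominus>\<^bsub>L2 M\<^esub> g) < min 1 r"
        using c(1) by (simp only: mult_less_cancel_left_pos)
      define v where "v = L2_abs M g"
      have v: "v \<in> qdom b" "v \<in> L2_pos M"
        using assms(5) gD L2_abs_in_L2_pos unfolding v_def first_Beurling_Deny_def by blast+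
      define f where "f = L2_meet M u v"
      have f: "f \<in> qdom b" and Qf: "Q f \<le> Q u + Q v"
        using shifted_form_meet_le[OF b assms(5) u(1) v(1)] by (simp_all add: f_def Q_def)
      have fpos: "f \<in> L2_pos M" and fu: "L2_le M f u" and fv: "L2_le M f v"
        using L2_meet_pos[OF u(2) v(2)] L2_meet_le[OF u(2) v(2)] by (simp_all add: f_def)
      have fc: "f \<in> carrier (L2 M)"
        by (rule clb(1)[OF f])
      have fDb: "f \<in> Db"
        using Db_ideal[OF g(1) f] fv by (simp add: L2_abs_of_pos[OF fpos] v_def)
      have Qv: "Q v \<le> Q g"
        unfolding Q_def v_def by (rule shifted_form_abs_le[OF assms(5) gD])
      have Qg: "Q g \<le> 2 * Q u + 2 * Q (u \<ominus>\<^bsub>L2 M\<^esub> g)"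
        by (rule L.parallelogram_le_minus[OF Db(2) Qpar Q0 u(1) gD(1)])
      have Qf': "Q f \<le> 3 * Q u + 2"
        using Qf Qv Qg Qug t(2) by linarith
      have Quf: "Q (u \<ominus>\<^bsub>L2 M\<^esub> f) \<le> 8 * Q u + 4"
      proof -
        have "Q (u \<ominus>\<^bsub>L2 M\<^esub> f) \<le> 2 * Q u + 2 * Q f"
          by (rule L.parallelogram_le(2)[OF Db(2) Qpar Q0 u(1) f])
        then show ?thesis
          using Qf' by linarith
      qed
      have nuf: "n (u \<ominus>\<^bsub>L2 M\<^esub> f) < min 1 r"
        using L2_meet_abs_dist[OF u(2) gD(2)] nug by (simp add: n_def f_def v_def)
      have nf: "n f \<le> 2 * n u + 2"
        using L.parallelogram_le_minus[OF L.carrier_is_submodule npar n0 u(3) fc] nuf by simp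
      obtain \<eta> where \<eta>: "\<eta> \<in> qdom a" "A \<eta> = f" "paired H M A \<xi> \<eta>"
        using lift[OF \<xi> f fpos] fu by (auto simp: u_def)
      have "f \<in> A ` Da"
        using assms(9) fDb fpos \<eta> by blast
      then obtain \<zeta> where \<zeta>: "\<zeta> \<in> Da" "A \<zeta> = f"
        by blast
      have "\<eta> \<in> Da"
        by (rule Da_ideal[OF \<zeta>(1) \<eta>(1)]) (simp add: \<eta>(2) \<zeta>(2) L2_le_def)
      moreover have "(hnorm H (\<eta> \<ominus>\<^bsub>H\<^esub> \<xi>))\<^sup>2 < r"
        using paired_dist[OF H map cla(1)[OF \<xi>] cla(1)[OF \<eta>(1)] \<eta>(3)] nuf
          parallelogram_minus_commute[OF carrier_is_submodule hnorm_parallelogram cla(1)[OF \<xi>] cla(1)[OF \<eta>(1)]]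
        by (simp add: n_def u_def \<eta>(2))
      moreover have "shifted_form H a \<mu>\<^sub>a \<eta> \<le> C"
      proof -
        have "shifted_form H a \<mu>\<^sub>a \<eta> \<le> shifted_form H a \<mu>\<^sub>a \<xi> + shifted_form (L2 M) b \<mu>\<^sub>a f
            + shifted_form (L2 M) b \<mu>\<^sub>a (u \<ominus>\<^bsub>L2 M\<^esub> f) - shifted_form (L2 M) b \<mu>\<^sub>a u"
          using dominated_form_estimate[OF H assms(2) a b(1) assms(8) \<xi> \<eta>(1,3)] fu
          by (simp add: u_def \<eta>(2))
        also have "\<dots> \<le> shifted_form H a \<mu>\<^sub>a \<xi> + Q f + Q (u \<ominus>\<^bsub>L2 M\<^esub> f)
            + \<bar>\<mu>\<^sub>a - \<mu>\<^sub>b\<bar> * (n f + n (u \<ominus>\<^bsub>L2 M\<^esub> f) + n u)"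
          using change[of f] change[of "u \<ominus>\<^bsub>L2 M\<^esub> f"] change[of u] Q0[OF u(1)]
          unfolding distrib_left by linarith
        also have "\<dots> \<le> C"
        proof -
          have "\<bar>\<mu>\<^sub>a - \<mu>\<^sub>b\<bar> * (n f + n (u \<ominus>\<^bsub>L2 M\<^esub> f) + n u) \<le> \<bar>\<mu>\<^sub>a - \<mu>\<^sub>b\<bar> * (3 * n u + 3)"
            using nf nuf by (intro mult_left_mono) simp_all
          then show ?thesis
            using Qf' Quf unfolding C_def by linarith
        qed
        finally show ?thesis .
      qed
      ultimately show ?thesis by blast
    qed
    then show "\<exists>g\<in>Da. form_norm H a \<mu>\<^sub>a (\<xi> \<ominus>\<^bsub>H\<^esub> g) < e"
      by (rule bounded_approximation_imp_form_approximation[OF assms(3) Da \<xi> _ e])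
  qed
qed

end
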